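(* For any given integer $m\geq 1$, there exist uncountably many transcendental analytic functions $\phi:\mathbb{R}\to\mathbb{R}$ with $|\phi'(x)|<0.0001$ for all $x\in\mathbb{R}$, $\phi(\overline{\mathbb{Q}}_m)\subseteq\mathbb{Q}$, and such that for every $\alpha\in\overline{\mathbb{Q}}_m$, \[\operatorname{den}(\phi(\alpha))\leq (2q)^{450m^5 2^{18m^2} q^{6m}},\] where $q=\mathcal{H}(\alpha)$.
   Context: $\overline{\mathbb{Q}}_m$ denotes the set of all real algebraic numbers of degree $m$. A function $f$ is transcendental if the only complex polynomial $P(x,y)$ with $P(x,f(x))=0$ for all $x$ in the domain of $f$ is the zero polynomial. For an algebraic number $\alpha$, $\mathcal{H}(\alpha)$ denotes its height, i.e. the maximum of the absolute values of the coefficients of its primitive minimal polynomial over $\mathbb{Z}$. For a rational number $z$, $\operatorname{den}(z)$ denotes its (reduced) denominator. *)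

theory Defs
  imports "HOL-Analysis.Analysis"
begin

definition real_analytic :: "(real \<Rightarrow> real) \<Rightarrow> bool" where
  "real_analytic f \<longleftrightarrow> (\<forall>a. \<exists>F. (\<lambda>h. f (a + h)) has_fps_expansion F)"

text \<open>
  Bivariate polynomials \<open>P(x,y)\<close> are elements of \<open>\<complex>[x][y]\<close>: the coefficients of the outer
  polynomial, which are polynomials in \<open>x\<close>, multiply the powers of \<open>y\<close>.
\<close>

definition poly2 :: "complex poly poly \<Rightarrow> complex \<Rightarrow> complex \<Rightarrow> complex" where
  "poly2 P x y = poly (poly P [:y:]) x"

definition transcendental_fun :: "(real \<Rightarrow> real) \<Rightarrow> bool" where
  "transcendental_fun f \<longleftrightarrow>
     (\<forall>P. (\<forall>x. poly2 P (complex_of_real x) (complex_of_real (f x)) = 0) \<longrightarrow> P = 0)"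

text \<open>
  The primitive minimal polynomial over \<open>\<int>\<close> is determined up to sign; the leading
  coefficient is taken to be positive. The degree and the height do not depend on this choice.
\<close>

definition is_min_int_poly :: "int poly \<Rightarrow> real \<Rightarrow> bool" where
  "is_min_int_poly p \<alpha> \<longleftrightarrow>
     p \<noteq> 0 \<and> poly (map_poly of_int p) \<alpha> = 0 \<and>
     (\<forall>g. g \<noteq> 0 \<and> poly (map_poly of_int g) \<alpha> = 0 \<longrightarrow> degree p \<le> degree g) \<and>
     content p = 1 \<and> lead_coeff p > 0"

definition min_int_poly :: "real \<Rightarrow> int poly" where
  "min_int_poly \<alpha> = (THE p. is_min_int_poly p \<alpha>)"

lemma poly_map_poly_of_int_smult:
  "poly (map_poly of_int (smult c p)) (\<alpha>::real) = of_int c * poly (map_poly of_int p) \<alpha>"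
proof -
  have "map_poly of_int (smult c p) = smult (of_int c :: real) (map_poly of_int p)"
    by (rule poly_eqI) (simp add: coeff_map_poly)
  thus ?thesis by simp
qed

lemma poly_map_poly_of_int_diff:
  "poly (map_poly of_int (p - q)) (\<alpha>::real) =
     poly (map_poly of_int p) \<alpha> - poly (map_poly of_int q) \<alpha>"
proof -
  have "map_poly of_int (p - q) = (map_poly of_int p - map_poly of_int q :: real poly)"
    by (rule poly_eqI) (simp add: coeff_map_poly)
  thus ?thesis by simp
qed

lemma is_min_int_poly_unique:
  assumes p: "is_min_int_poly p \<alpha>" and g: "is_min_int_poly g \<alpha>"
  shows "p = g"
proof -
  let ?a = "lead_coeff g" and ?b = "lead_coeff p"
  have deg: "degree p = degree g"
    using p g by (auto simp: is_min_int_poly_def intro: antisym)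
  define r where "r = smult ?a p - smult ?b g"
  have root: "poly (map_poly of_int r) \<alpha> = 0"
    using p g
    by (simp add: r_def is_min_int_poly_def poly_map_poly_of_int_smult poly_map_poly_of_int_diff)
  have "r = 0"
  proof (rule ccontr)
    assume r: "r \<noteq> 0"
    have "coeff r (degree p) = 0"
      by (simp add: r_def deg mult.commute)
    moreover have "degree r \<le> degree p"
      unfolding r_def using deg
      by (intro degree_diff_le) (auto intro: order.trans[OF degree_smult_le])
    ultimately have "degree r < degree p"
      using r by (metis leading_coeff_0_iff le_neq_implies_less)
    with p r root show False by (auto simp: is_min_int_poly_def)
  qed
  hence eq: "smult ?a p = smult ?b g" by (simp add: r_def)
  hence "content (smult ?a p) = content (smult ?b g)" by simp
  hence "?a = ?b" using p g by (simp add: is_min_int_poly_def)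
  hence "smult ?b (p - g) = 0" using eq by (simp add: smult_diff_right)
  thus ?thesis using p by (simp add: is_min_int_poly_def)
qed

lemma is_min_int_poly_exists:
  assumes "algebraic (\<alpha>::real)"
  shows "\<exists>p. is_min_int_poly p \<alpha>"
proof -
  let ?R = "\<lambda>p::int poly. p \<noteq> 0 \<and> poly (map_poly of_int p) \<alpha> = 0"
  obtain p0 where p0: "\<forall>i. coeff p0 i \<in> \<int>" "p0 \<noteq> 0" "poly p0 \<alpha> = 0"
    using assms by (auto elim: algebraicE)
  define p1 where "p1 = map_poly floor p0"
  have p1: "map_poly of_int p1 = p0"
    by (rule poly_eqI) (use p0 in \<open>simp add: p1_def coeff_map_poly\<close>)
  with p0 have "?R p1" by auto
  then obtain p where p: "?R p" and min: "\<And>g. ?R g \<Longrightarrow> degree p \<le> degree g"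
    using ex_has_least_nat[of ?R p1 degree] by blast
  let ?q = "primitive_part p" and ?s = "sgn (lead_coeff p)"
  have c: "content p > 0"
    using p by (metis content_eq_zero_iff normalize_content normalize_int_def zero_less_abs_iff)
  have pq: "p = smult (content p) ?q" by simp
  have q: "?R ?q"
    using p c poly_map_poly_of_int_smult[of "content p" ?q \<alpha>] by simp
  have lc: "lead_coeff p = content p * lead_coeff ?q"
    by (metis lead_coeff_smult pq)
  have s: "?s \<noteq> 0" "\<bar>?s\<bar> = 1" using p by (auto simp: sgn_if)
  have "is_min_int_poly (smult ?s ?q) \<alpha>"
    unfolding is_min_int_poly_def
  proof (intro conjI allI impI)
    show "smult ?s ?q \<noteq> 0" using q s by simp
    show "poly (map_poly of_int (smult ?s ?q)) \<alpha> = 0"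
      using q by (simp add: poly_map_poly_of_int_smult)
    show "degree (smult ?s ?q) \<le> degree g" if "?R g" for g
      using min[OF that] s by simp
    show "content (smult ?s ?q) = 1"
      using p s by (simp add: content_primitive_part)
    have "lead_coeff ?q \<noteq> 0" using q leading_coeff_0_iff by blast
    thus "lead_coeff (smult ?s ?q) > 0"
      using c unfolding lead_coeff_smult lc by (auto simp: sgn_if zero_less_mult_iff)
  qed
  thus ?thesis ..
qed

lemma is_min_int_poly_min_int_poly:
  "algebraic \<alpha> \<Longrightarrow> is_min_int_poly (min_int_poly \<alpha>) \<alpha>"
  unfolding min_int_poly_def
  by (rule theI') (metis is_min_int_poly_exists is_min_int_poly_unique)

definition real_algebraic_deg :: "nat \<Rightarrow> real set" where
  "real_algebraic_deg m = {\<alpha>. algebraic \<alpha> \<and> degree (min_int_poly \<alpha>) = m}"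

definition alg_height :: "real \<Rightarrow> nat" where
  "alg_height \<alpha> = nat (Max (abs ` set (coeffs (min_int_poly \<alpha>))))"

text \<open>Only meaningful for rational arguments.\<close>

definition den :: "real \<Rightarrow> nat" where
  "den z = nat (snd (quotient_of (THE r. z = of_rat r)))"

lemma den_of_rat: "den (of_rat r) = nat (snd (quotient_of r))"
  by (simp add: den_def)

end

theory Submission
  imports Defs "HOL-Complex_Analysis.Complex_Analysis" "HOL-Real_Asymp.Real_Asymp"
    "Subresultants.Subresultant_Gcd"
begin

text \<open>
  Enumerate the real algebraic numbers of degree at most \<open>m\<close> as \<open>a\<^sub>0, a\<^sub>1, \<dots>\<close> with nondecreasing
  heights, put \<open>h(z) = z/(1+z\<^sup>2)\<close>, and look for
  \<open>\<phi>(x) = exp(-x\<^sup>2) \<Sum>\<^sub>n c\<^sub>n \<Prod>\<^sub>k\<^sub><\<^sub>n h(x - a\<^sub>k)\<close>. On the strip \<open>\<bar>Im z\<bar> < 1/2\<close> we have \<open>\<bar>h\<bar> \<le> 2\<close>,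
  so \<open>\<bar>c\<^sub>n\<bar> \<le> 10\<^sup>-\<^sup>6 4\<^sup>-\<^sup>n\<close> makes \<open>\<phi>\<close> analytic, and Cauchy's inequality bounds \<open>\<phi>'\<close>. The value
  \<open>\<phi>(a\<^sub>n)\<close> depends on \<open>c\<^sub>0, \<dots>, c\<^sub>n\<close> only, so \<open>c\<^sub>n\<close> can be chosen, in two ways at each step, such that
  \<open>\<phi>(a\<^sub>n)\<close> is a nonzero rational with a prescribed denominator \<open>D\<^sub>n\<close>, as soon as \<open>D\<^sub>n\<close> is about
  \<open>10\<^sup>6 4\<^sup>n\<close> divided by the \<open>n\<close>-th basis function at \<open>a\<^sub>n\<close>; the binary choices give uncountably many
  functions. A root separation bound, obtained from the nonvanishing of an integer resultant,
  bounds \<open>D\<^sub>n\<close>. Finally \<open>\<phi>\<close> is transcendental because it decays faster than any power of \<open>x\<close>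
  although it vanishes at no natural number.
\<close>

section \<open>Separation of real algebraic numbers\<close>

text \<open>The Leibniz expansion has \<open>fact n\<close> terms, and each picks exactly one entry
  from every column. Bounds per column are used because \<open>liouville_resultant\<close> needs one
  column to be much smaller than the others.\<close>

lemma abs_det_le:
  fixes A :: "real mat"
  assumes A: "A \<in> carrier_mat n n"
    and B: "\<And>i j. i < n \<Longrightarrow> j < n \<Longrightarrow> \<bar>A $$ (i,j)\<bar> \<le> B j"
  shows "\<bar>Determinant.det A\<bar> \<le> fact n * (\<Prod>j<n. B j)"
proof -
  have "\<bar>Determinant.det A\<bar> \<le> (\<Sum>p | p permutes {0..<n}. \<bar>signof p * (\<Prod>i = 0..<n. A $$ (i, p i))\<bar>)"
    unfolding det_def'[OF A] by (rule sum_abs)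
  also have "\<dots> \<le> (\<Sum>p | p permutes {0..<n}. \<Prod>j<n. B j)"
  proof (rule sum_mono, clarify)
    fix p assume p: "p permutes {0..<n}"
    have "\<bar>signof p * (\<Prod>i = 0..<n. A $$ (i, p i))\<bar> = (\<Prod>i = 0..<n. \<bar>A $$ (i, p i)\<bar>)"
      by (simp add: abs_mult abs_prod sign_def)
    also have "\<dots> \<le> (\<Prod>i = 0..<n. B (p i))"
      using permutes_in_image[OF p] by (intro prod_mono conjI B) auto
    also have "\<dots> = (\<Prod>i = 0..<n. B i)"
      using prod.permute[OF p, of B] by (simp add: o_def)
    finally show "\<bar>signof p * (\<Prod>i = 0..<n. A $$ (i, p i))\<bar> \<le> (\<Prod>j<n. B j)"
      by (simp add: atLeast0LessThan)
  qed
  also have "\<dots> = fact n * (\<Prod>j<n. B j)"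
    by (simp add: card_permutations[OF refl])
  finally show ?thesis .
qed

text \<open>Row \<open>i\<close> of the Sylvester matrix lists the coefficients of a shifted copy
  \<open>x ^ k * p\<close> or \<open>x ^ k * g\<close>, highest power first, so its product with the
  vector of powers evaluates that polynomial at \<open>x\<close>.\<close>

lemma sylvester_mat_mult_powers:
  fixes p g :: "'a::comm_ring_1 poly" and x :: 'a
  defines "N \<equiv> degree p + degree g"
  assumes i: "i < N"
  shows "(sylvester_mat p g *\<^sub>v vec N (\<lambda>j. x ^ (N - 1 - j))) $ i =
    (if i < degree g then x ^ (degree g - 1 - i) * poly p x
     else x ^ (N - 1 - i) * poly g x)"
proof -
  define r where "r = (if i < degree g then Polynomial.monom 1 (degree g - 1 - i) * p
                       else Polynomial.monom 1 (N - 1 - i) * g)"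
  have deg: "degree r < N"
  proof (cases "i < degree g")
    case True
    have "degree r \<le> degree g - 1 - i + degree p"
      using True unfolding r_def
      by (auto intro!: order.trans[OF degree_mult_le] simp: degree_monom_eq)
    then show ?thesis using True by (simp add: N_def)
  next
    case False
    have "degree r \<le> N - 1 - i + degree g"
      using False unfolding r_def
      by (auto intro!: order.trans[OF degree_mult_le] simp: degree_monom_eq)
    then show ?thesis using False i by (simp add: N_def)
  qed
  have ent: "sylvester_mat p g $$ (i,j) = coeff r (N - 1 - j)" if j: "j < N" for j
  proof -
    \<comment> \<open>The entry formula \<open>sylvester_index_mat2\<close> has both the exponent of
      the monomial and the index of the coefficient one larger than in \<open>r\<close>; this
      removes the common shift.\<close>
    have *: "coeff (Polynomial.monom 1 (Suc k) * f) (N - j) = coeff (Polynomial.monom 1 k * f) (N - 1 - j)"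
      for k and f :: "'a poly"
      using j by (auto simp: coeff_monom_mult Suc_diff_Suc)
    have "Suc (degree g - 1 - i) = degree g - i" if "i < degree g"
      using that by simp
    moreover have "Suc (N - 1 - i) = N - i" using i by simp
    ultimately show ?thesis
      using sylvester_index_mat2[of i p g j] i j
        *[of "degree g - 1 - i" p] *[of "N - 1 - i" g]
      by (auto simp: N_def r_def)
  qed
  have "(sylvester_mat p g *\<^sub>v vec N (\<lambda>j. x ^ (N - 1 - j))) $ i
      = (\<Sum>j<N. coeff r (N - 1 - j) * x ^ (N - 1 - j))"
    using i by (auto simp: N_def scalar_prod_def atLeast0LessThan ent intro!: sum.cong)
  also have "\<dots> = (\<Sum>j<N. coeff r j * x ^ j)"
    by (rule sum.reindex_bij_witness[of _ "\<lambda>j. N - 1 - j" "\<lambda>j. N - 1 - j"]) auto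
  also have "\<dots> = (\<Sum>j\<le>degree r. coeff r j * x ^ j)"
    using deg by (intro sum.mono_neutral_right) (auto simp: coeff_eq_0)
  also have "\<dots> = poly r x" by (simp add: poly_altdef)
  finally show ?thesis by (auto simp: r_def poly_monom)
qed

text \<open>
  The vector of powers of \<open>\<alpha>\<close> is mapped by the Sylvester matrix to a vector whose entries are all
  multiples of \<open>g(\<alpha>)\<close>; Cramer's rule for its last entry, which is \<open>1\<close>, then writes the resultant
  as \<open>g(\<alpha>)\<close> times a bounded determinant.
\<close>

lemma liouville_resultant:
  fixes p g :: "int poly" and \<alpha> K :: real
  assumes res: "resultant p g \<noteq> 0" and N: "degree p + degree g > 0"
    and root: "poly (map_poly of_int p) \<alpha> = 0"
    and cp: "\<And>i. \<bar>of_int (coeff p i)\<bar> \<le> K" and cg: "\<And>i. \<bar>of_int (coeff g i)\<bar> \<le> K"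
    and K: "\<And>i. i < degree p \<Longrightarrow> \<bar>\<alpha>\<bar> ^ i \<le> K" and K0: "K \<ge> 1"
  shows "1 \<le> \<bar>poly (map_poly of_int g) \<alpha>\<bar> * fact (degree p + degree g) * K ^ (degree p + degree g)"
proof -
  define N where "N = degree p + degree g"
  define P where "P = map_poly real_of_int p"
  define G where "G = map_poly real_of_int g"
  have [simp]: "degree P = degree p" "degree G = degree g"
    by (simp_all add: P_def G_def)
  define S where "S = sylvester_mat P G"
  define v where "v = vec N (\<lambda>j. \<alpha> ^ (N - 1 - j))"
  have S: "S \<in> carrier_mat N N" and v: "v \<in> carrier_vec N"
    using sylvester_carrier_mat[of P G] by (auto simp: S_def N_def v_def)
  have "N > 0" using N by (simp add: N_def)
  have "Determinant.det S = of_int (resultant p g)"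
    unfolding S_def P_def G_def resultant_def[symmetric]
    by (rule of_int_hom.resultant_map_poly) simp_all
  then have "1 \<le> \<bar>Determinant.det S\<bar>" using res by simp
  also have "Determinant.det S = Determinant.det (replace_col S (S *\<^sub>v v) (N - 1))"
    using cramer_lemma_mat[OF S v, of "N - 1"] \<open>N > 0\<close> by (simp add: v_def)
  also have "\<bar>\<dots>\<bar> \<le> fact N * (\<Prod>j<N. if j = N - 1 then \<bar>poly G \<alpha>\<bar> * K else K)"
  proof (rule abs_det_le)
    show "replace_col S (S *\<^sub>v v) (N - 1) \<in> carrier_mat N N"
      using S by (auto simp: replace_col_def)
    fix i j assume ij: "i < N" "j < N"
    \<comment> \<open>The first \<open>degree g\<close> entries are multiples of
      \<open>poly P \<alpha> = 0\<close>. The others are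
      \<open>\<alpha> ^ k * poly G \<alpha>\<close> with \<open>k < degree p\<close>, and these are
      the powers that \<open>K\<close> bounds.\<close>
    have b: "\<bar>(S *\<^sub>v v) $ i\<bar> \<le> \<bar>poly G \<alpha>\<bar> * K"
    proof (cases "i < degree g")
      case True
      then show ?thesis
        using sylvester_mat_mult_powers[of i P G \<alpha>] ij root K0
        by (simp add: N_def S_def v_def P_def)
    next
      case False
      then have "\<bar>\<alpha>\<bar> ^ (N - 1 - i) \<le> K" using ij by (intro K) (simp add: N_def)
      then show ?thesis
        using sylvester_mat_mult_powers[of i P G \<alpha>] ij False
        by (simp add: N_def S_def v_def abs_mult power_abs mult.commute[of _ "\<bar>poly G \<alpha>\<bar>"] mult_left_mono)
    qed
    have "\<bar>S $$ (i,j)\<bar> \<le> K"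
      using sylvester_index_mat[of i P G j] ij cp cg K0 order.trans[OF zero_le_one K0]
      by (auto simp: S_def N_def P_def G_def)
    with b show "\<bar>replace_col S (S *\<^sub>v v) (N - 1) $$ (i, j)\<bar>
        \<le> (if j = N - 1 then \<bar>poly G \<alpha>\<bar> * K else K)"
      using S ij by (auto simp: replace_col_def)
  qed
  also have "(\<Prod>j<N. if j = N - 1 then \<bar>poly G \<alpha>\<bar> * K else K) = \<bar>poly G \<alpha>\<bar> * K ^ N"
  proof -
    obtain M where M: "N = Suc M" using \<open>N > 0\<close> by (cases N) auto
    show ?thesis by (simp add: M)
  qed
  finally show ?thesis by (simp add: G_def N_def mult_ac)
qed

lemma is_min_int_poly_degree_pos:
  assumes "is_min_int_poly p \<alpha>"
  shows "degree p > 0"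
proof (rule ccontr)
  assume "\<not> degree p > 0"
  then obtain c where "p = [:c:]" by (metis degree_eq_zeroE gr0I)
  then show False using assms by (auto simp: is_min_int_poly_def map_poly_pCons)
qed

lemma abs_coeff_min_int_poly_le:
  "\<bar>coeff (min_int_poly \<alpha>) i\<bar> \<le> int (alg_height \<alpha>)"
proof -
  let ?p = "min_int_poly \<alpha>" and ?S = "abs ` set (coeffs (min_int_poly \<alpha>))"
  show ?thesis
  proof (cases "coeff ?p i = 0")
    case False
    then have "coeff ?p i \<in> set (coeffs ?p)"
      by (metis coeff_in_coeffs le_degree coeff_0)
    then have "\<bar>coeff ?p i\<bar> \<le> Max ?S" by (intro Max_ge) auto
    moreover from this have "0 \<le> Max ?S" by linarith
    ultimately show ?thesis by (simp add: alg_height_def)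
  qed simp
qed

lemma alg_height_pos:
  assumes "algebraic \<alpha>"
  shows "alg_height \<alpha> \<ge> 1"
  using abs_coeff_min_int_poly_le[of \<alpha> "degree (min_int_poly \<alpha>)"]
    is_min_int_poly_min_int_poly[OF assms] by (auto simp: is_min_int_poly_def)

lemma abs_poly_le:
  fixes p :: "real poly"
  assumes "\<And>i. \<bar>coeff p i\<bar> \<le> C" and "\<bar>x\<bar> \<le> R" and "R \<ge> 1" and "degree p < n"
  shows "\<bar>poly p x\<bar> \<le> n * C * R ^ n"
proof -
  have C: "0 \<le> C" using assms(1)[of 0] by linarith
  have "\<bar>poly p x\<bar> = \<bar>\<Sum>i<n. coeff p i * x ^ i\<bar>"
    unfolding poly_altdef
    by (rule arg_cong[where f = abs], rule sum.mono_neutral_left)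
      (use assms in \<open>auto simp: coeff_eq_0\<close>)
  also have "\<dots> \<le> (\<Sum>i<n. \<bar>coeff p i * x ^ i\<bar>)" by (rule sum_abs)
  also have "\<dots> \<le> (\<Sum>i<n. C * R ^ n)"
  proof (rule sum_mono)
    fix i assume "i \<in> {..<n}"
    then have "\<bar>x\<bar> ^ i \<le> R ^ n"
      using assms(2,3) by (meson abs_ge_zero lessThan_iff less_imp_le order_trans power_increasing power_mono)
    then show "\<bar>coeff p i * x ^ i\<bar> \<le> C * R ^ n"
      unfolding abs_mult power_abs using assms(1) C by (intro mult_mono) auto
  qed
  finally show ?thesis by simp
qed

text \<open>Cauchy's root bound: the leading coefficient is at least 1, so for
  \<open>\<bar>\<alpha>\<bar> > 1\<close> the top power is dominated by a geometric sum with
  coefficients at most the height.\<close>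

lemma algebraic_abs_le_height:
  assumes "algebraic \<alpha>"
  shows "\<bar>\<alpha>\<bar> \<le> alg_height \<alpha> + 1"
proof (cases "\<bar>\<alpha>\<bar> \<le> 1")
  case False
  define p where "p = min_int_poly \<alpha>"
  define q where "q = real (alg_height \<alpha>)"
  have p: "is_min_int_poly p \<alpha>" using is_min_int_poly_min_int_poly[OF assms] by (simp add: p_def)
  obtain n where n: "degree p = Suc n" using is_min_int_poly_degree_pos[OF p] by (cases "degree p") auto
  have lc: "1 \<le> lead_coeff p" using p by (simp add: is_min_int_poly_def)
  let ?x = "\<bar>\<alpha>\<bar>"
  have "0 = poly (map_poly real_of_int p) \<alpha>" using p by (simp add: is_min_int_poly_def)
  also have "\<dots> = (\<Sum>i\<le>Suc n. real_of_int (coeff p i) * \<alpha> ^ i)"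
    by (simp add: poly_altdef n)
  finally have "of_int (lead_coeff p) * \<alpha> ^ Suc n = - (\<Sum>i<Suc n. real_of_int (coeff p i) * \<alpha> ^ i)"
    by (simp add: n lessThan_Suc_atMost)
  then have "\<bar>of_int (lead_coeff p) * \<alpha> ^ Suc n\<bar> = \<bar>\<Sum>i<Suc n. real_of_int (coeff p i) * \<alpha> ^ i\<bar>"
    by simp
  also have "\<dots> \<le> (\<Sum>i<Suc n. \<bar>real_of_int (coeff p i) * \<alpha> ^ i\<bar>)" by (rule sum_abs)
  also have "\<dots> \<le> (\<Sum>i<Suc n. q * ?x ^ i)"
  proof (rule sum_mono)
    fix i
    have "\<bar>real_of_int (coeff p i)\<bar> \<le> q"
      using abs_coeff_min_int_poly_le[of \<alpha> i] by (simp add: p_def q_def)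
    then show "\<bar>real_of_int (coeff p i) * \<alpha> ^ i\<bar> \<le> q * ?x ^ i"
      by (simp add: abs_mult power_abs mult_right_mono)
  qed
  also have "\<dots> = q * (?x ^ Suc n - 1) / (?x - 1)"
    using False by (subst sum_distrib_left[symmetric], subst geometric_sum) auto
  finally have "\<bar>of_int (lead_coeff p) * \<alpha> ^ Suc n\<bar> \<le> q * (?x ^ Suc n - 1) / (?x - 1)" .
  moreover have "?x ^ Suc n \<le> \<bar>of_int (lead_coeff p) * \<alpha> ^ Suc n\<bar>"
  proof -
    have "1 * ?x ^ Suc n \<le> of_int (lead_coeff p) * ?x ^ Suc n"
      using lc by (intro mult_right_mono) (auto simp del: power_Suc)
    then show ?thesis using lc by (simp add: abs_mult power_abs)
  qed
  ultimately have "?x ^ Suc n \<le> q * (?x ^ Suc n - 1) / (?x - 1)" by linarith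
  then have "?x ^ Suc n * (?x - 1) \<le> q * (?x ^ Suc n - 1)"
    using False by (simp add: pos_le_divide_eq del: power_Suc)
  also have "\<dots> \<le> q * ?x ^ Suc n" by (simp add: q_def algebra_simps)
  finally have "?x ^ Suc n * (?x - 1) \<le> ?x ^ Suc n * q" by (simp add: mult.commute)
  then have "?x - 1 \<le> q"
    using False by (subst (asm) mult_le_cancel_left_pos) auto
  then show ?thesis by (simp add: q_def)
qed simp

text \<open>If the resultant were zero, \<open>gcd p g\<close> would have positive degree. It cannot
  vanish at \<open>\<alpha>\<close> because \<open>g\<close> does not, so the cofactor of the gcd in
  \<open>p\<close> vanishes there, against the minimality of \<open>degree p\<close>.\<close>

lemma resultant_min_int_poly_nonzero:
  assumes p: "is_min_int_poly p \<alpha>" and g: "poly (map_poly of_int g) \<alpha> \<noteq> 0"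
  shows "resultant p g \<noteq> 0"
proof
  assume "resultant p g = 0"
  then have d: "degree (gcd p g) \<noteq> 0" by (simp add: resultant_0_gcd)
  obtain e where e: "p = gcd p g * e" by (meson dvdE gcd_dvd1)
  obtain f where f: "g = gcd p g * f" by (meson dvdE gcd_dvd2)
  have "poly (map_poly of_int (gcd p g)) \<alpha> \<noteq> 0"
  proof
    assume "poly (map_poly of_int (gcd p g)) \<alpha> = 0"
    then have "poly (map_poly of_int (gcd p g * f)) \<alpha> = 0"
      by (simp add: of_int_poly_hom.hom_mult)
    with f g show False by simp
  qed
  moreover have "poly (map_poly of_int (gcd p g * e)) \<alpha> = 0"
    using p e by (simp add: is_min_int_poly_def)
  ultimately have "poly (map_poly of_int e) \<alpha> = 0"
    by (simp add: of_int_poly_hom.hom_mult)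
  moreover have "p \<noteq> 0" using p by (simp add: is_min_int_poly_def)
  then have "e \<noteq> 0" "gcd p g \<noteq> 0" using e by auto
  ultimately have "degree p \<le> degree e" using p by (simp add: is_min_int_poly_def)
  also have "degree p = degree (gcd p g) + degree e"
    using e degree_mult_eq[OF \<open>gcd p g \<noteq> 0\<close> \<open>e \<noteq> 0\<close>] by simp
  finally show False using d by simp
qed

text \<open>
  If the minimal polynomials differ, take \<open>g = r\<close> and \<open>\<xi> = \<beta>\<close>; for conjugates take the derivative
  of \<open>p\<close>, with a zero \<open>\<xi>\<close> supplied by Rolle's theorem.
\<close>

lemma separating_poly:
  assumes p: "is_min_int_poly p \<alpha>" and r: "is_min_int_poly r \<beta>"
    and dle: "degree r \<le> degree p" and m: "degree p \<le> m" and ne: "\<alpha> \<noteq> \<beta>"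
    and cp: "\<And>i. \<bar>coeff p i\<bar> \<le> q" and cr: "\<And>i. \<bar>coeff r i\<bar> \<le> q"
  obtains g :: "int poly" and \<xi> where
    "degree g \<le> m" "\<And>i. \<bar>coeff g i\<bar> \<le> m * q" "poly (map_poly of_int g) \<xi> = 0"
    "poly (map_poly of_int g) \<alpha> \<noteq> 0" "\<xi> \<in> {min \<alpha> \<beta>..max \<alpha> \<beta>}"
proof (cases "p = r")
  case False
  have "poly (map_poly of_int r) \<alpha> \<noteq> 0"
  proof
    assume "poly (map_poly of_int r) \<alpha> = 0"
    \<comment> \<open>Since \<open>degree r \<le> degree p\<close>, minimality passes from
      \<open>p\<close> to \<open>r\<close>, and uniqueness then gives \<open>p = r\<close>.\<close>
    then have "is_min_int_poly r \<alpha>"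
      using p r dle unfolding is_min_int_poly_def by (meson order_trans)
    then show False using p False is_min_int_poly_unique by blast
  qed
  moreover have "\<bar>coeff r i\<bar> \<le> m * q" for i
  proof -
    have "0 \<le> q" using cp[of 0] by linarith
    moreover have "m \<ge> 1" using is_min_int_poly_degree_pos[OF p] m by simp
    ultimately have "1 * q \<le> m * q" by (intro mult_right_mono) auto
    then show ?thesis using cr[of i] by simp
  qed
  ultimately show ?thesis
    using r dle m by (intro that[of r \<beta>]) (auto simp: is_min_int_poly_def)
next
  case True
  define P where "P = map_poly real_of_int p"
  have roots: "poly P \<alpha> = 0" "poly P \<beta> = 0"
    using p r True by (auto simp: P_def is_min_int_poly_def)
  have "min \<alpha> \<beta> < max \<alpha> \<beta>" using ne by auto
  from poly_MVT[OF this, of P] obtain \<xi> where \<xi>: "min \<alpha> \<beta> < \<xi>" "\<xi> < max \<alpha> \<beta>"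
    "poly P (max \<alpha> \<beta>) - poly P (min \<alpha> \<beta>) = (max \<alpha> \<beta> - min \<alpha> \<beta>) * poly (pderiv P) \<xi>"
    by auto
  then have "poly (pderiv P) \<xi> = 0" using roots ne by (auto simp: min_def max_def split: if_splits)
  moreover have pd: "map_poly of_int (pderiv p) = pderiv P"
    by (simp add: P_def of_int_hom.map_poly_pderiv)
  moreover have "poly (pderiv P) \<alpha> \<noteq> 0"
  proof
    assume "poly (pderiv P) \<alpha> = 0"
    moreover have "pderiv p \<noteq> 0" using is_min_int_poly_degree_pos[OF p] by (simp add: pderiv_eq_0_iff)
    ultimately have "degree p \<le> degree (pderiv p)" using p pd by (simp add: is_min_int_poly_def)
    then show False using is_min_int_poly_degree_pos[OF p] by (simp add: degree_pderiv)
  qed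
  moreover have "\<bar>coeff (pderiv p) i\<bar> \<le> m * q" for i
  proof (cases "Suc i \<le> degree p")
    case True
    then have "\<bar>int (Suc i)\<bar> * \<bar>coeff p (Suc i)\<bar> \<le> m * q" using m cp by (intro mult_mono) auto
    then show ?thesis by (simp add: coeff_pderiv abs_mult)
  next
    case False
    then have "coeff (pderiv p) i = 0" by (simp add: coeff_pderiv coeff_eq_0)
    moreover have "0 \<le> q" using cp[of 0] by linarith
    ultimately show ?thesis by simp
  qed
  ultimately show ?thesis
    using \<xi> m by (intro that[of "pderiv p" \<xi>]) (auto simp: degree_pderiv)
qed

text \<open>With \<open>g\<close> and its zero \<open>\<xi>\<close> from
  \<open>separating_poly\<close>, the mean value theorem bounds
  \<open>\<bar>poly G \<alpha>\<bar>\<close> above by a multiple of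
  \<open>\<bar>\<alpha> - \<beta>\<bar>\<close>, while \<open>liouville_resultant\<close> keeps it
  away from 0. The degrees are ordered as \<open>separating_poly\<close> requires.\<close>

lemma algebraic_separation_aux:
  assumes alg: "algebraic \<alpha>" "algebraic \<beta>" and ne: "\<alpha> \<noteq> \<beta>"
    and deg: "degree (min_int_poly \<beta>) \<le> degree (min_int_poly \<alpha>)" "degree (min_int_poly \<alpha>) \<le> m"
    and ht: "alg_height \<alpha> \<le> q" "alg_height \<beta> \<le> q"
  shows "1 \<le> \<bar>\<alpha> - \<beta>\<bar> * real (2 * q) ^ (15 * m\<^sup>2)"
proof -
  define p where "p = min_int_poly \<alpha>"
  define t where "t = real (2 * q)"
  have p: "is_min_int_poly p \<alpha>" using is_min_int_poly_min_int_poly[OF alg(1)] by (simp add: p_def)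
  have q1: "q \<ge> 1" using alg_height_pos[OF alg(1)] ht by simp
  have m1: "m \<ge> 1" using is_min_int_poly_degree_pos[OF p] deg by (simp add: p_def)
  have "\<bar>coeff p i\<bar> \<le> int q" "\<bar>coeff (min_int_poly \<beta>) i\<bar> \<le> int q" for i
    using abs_coeff_min_int_poly_le[of \<alpha> i] abs_coeff_min_int_poly_le[of \<beta> i] ht
    by (auto simp: p_def)
  then obtain g \<xi> where g: "degree g \<le> m" "\<And>i. \<bar>coeff g i\<bar> \<le> int m * int q"
    "poly (map_poly of_int g) \<xi> = 0" "poly (map_poly of_int g) \<alpha> \<noteq> 0"
    "\<xi> \<in> {min \<alpha> \<beta>..max \<alpha> \<beta>}"
    using separating_poly[OF p is_min_int_poly_min_int_poly[OF alg(2)], of m "int q"] deg ne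
    unfolding p_def by blast
  define G where "G = map_poly real_of_int g"
  have cG: "\<bar>coeff G i\<bar> \<le> m * q" for i
  proof -
    have "real_of_int \<bar>coeff g i\<bar> \<le> real_of_int (int m * int q)" using g(2) unfolding of_int_le_iff .
    then show ?thesis by (simp add: G_def)
  qed
  have bnd: "\<bar>x\<bar> \<le> real q + 1" if "x \<in> {min \<alpha> \<beta>..max \<alpha> \<beta>}" for x
    using algebraic_abs_le_height[OF alg(1)] algebraic_abs_le_height[OF alg(2)] ht that
    by (auto simp: min_def max_def abs_if split: if_splits)
  have xa: "\<xi> \<noteq> \<alpha>" using g by auto
  have Ga: "\<bar>poly G \<alpha>\<bar> \<le> \<bar>\<alpha> - \<beta>\<bar> * (m * (m * (m * q)) * (real q + 1) ^ m)"
  proof -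
    have "min \<xi> \<alpha> < max \<xi> \<alpha>" using xa by auto
    from poly_MVT[OF this, of G] obtain y where y: "min \<xi> \<alpha> < y" "y < max \<xi> \<alpha>"
      "poly G (max \<xi> \<alpha>) - poly G (min \<xi> \<alpha>) = (max \<xi> \<alpha> - min \<xi> \<alpha>) * poly (pderiv G) y"
      by auto
    have "\<bar>poly G \<alpha>\<bar> = \<bar>poly G (max \<xi> \<alpha>) - poly G (min \<xi> \<alpha>)\<bar>"
      using g(3) by (auto simp: G_def min_def max_def)
    also have "\<dots> = \<bar>\<xi> - \<alpha>\<bar> * \<bar>poly (pderiv G) y\<bar>"
      unfolding y(3) abs_mult by (auto simp: min_def max_def)
    also have "\<dots> \<le> \<bar>\<alpha> - \<beta>\<bar> * (m * (m * (m * q)) * (real q + 1) ^ m)"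
    proof (rule mult_mono)
      show "\<bar>\<xi> - \<alpha>\<bar> \<le> \<bar>\<alpha> - \<beta>\<bar>" using g(5) by (auto simp: min_def max_def split: if_splits)
      have "\<bar>poly (pderiv G) y\<bar> \<le> m * real (m * (m * q)) * (real q + 1) ^ m"
      proof (rule abs_poly_le)
        show "\<bar>y\<bar> \<le> real q + 1" using y g(5) by (intro bnd) (auto simp: min_def max_def split: if_splits)
        show "degree (pderiv G) < m" using m1 g(1) by (auto simp: degree_pderiv G_def)
        show "\<bar>coeff (pderiv G) i\<bar> \<le> m * (m * q)" for i
        proof (cases "Suc i \<le> degree g")
          case True
          then have "\<bar>real (Suc i)\<bar> * \<bar>coeff G (Suc i)\<bar> \<le> real m * real (m * q)"
            using g(1) cG[of "Suc i"] by (intro mult_mono) (auto simp del: of_nat_Suc)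
          then show ?thesis by (simp add: coeff_pderiv abs_mult)
        next
          case False
          then have "coeff (pderiv G) i = 0" by (simp add: coeff_pderiv coeff_eq_0 G_def)
          then show ?thesis by simp
        qed
      qed auto
      then show "\<bar>poly (pderiv G) y\<bar> \<le> m * (m * (m * q)) * (real q + 1) ^ m" by simp
    qed auto
    finally show ?thesis .
  qed
  \<comment> \<open>All factors are at least 1, so \<open>K\<close> dominates the coefficients of
    \<open>p\<close> (at most \<open>q\<close>), those of \<open>g\<close> (at most
    \<open>m * q\<close>) and the powers of \<open>\<alpha>\<close> (at most
    \<open>(q + 1) ^ m\<close>).\<close>
  define K where "K = real m * q * (real q + 1) ^ m"
  have pw1: "(real q + 1) ^ m \<ge> 1" by (intro one_le_power) simp
  have mq1: "real m * q \<ge> 1"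
    using m1 q1 by (metis mult_le_mono nat_mult_1 of_nat_1 of_nat_le_iff of_nat_mult)
  have mqK: "real m * q \<le> K" unfolding K_def using mult_left_mono[OF pw1, of "real m * q"] by simp
  have "1 \<le> \<bar>poly G \<alpha>\<bar> * fact (degree p + degree g) * K ^ (degree p + degree g)"
    unfolding G_def
  proof (rule liouville_resultant)
    show "resultant p g \<noteq> 0" by (rule resultant_min_int_poly_nonzero[OF p g(4)])
    show "0 < degree p + degree g" using is_min_int_poly_degree_pos[OF p] by simp
    show "poly (map_poly of_int p) \<alpha> = 0" using p by (simp add: is_min_int_poly_def)
    show "\<bar>of_int (coeff g i)\<bar> \<le> K" for i using cG[of i] mqK by (simp add: G_def)
    show "\<bar>of_int (coeff p i)\<bar> \<le> K" for i
    proof -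
      have "real_of_int \<bar>coeff p i\<bar> \<le> real_of_int (int q)"
        using abs_coeff_min_int_poly_le[of \<alpha> i] ht unfolding p_def of_int_le_iff by linarith
      also have "\<dots> \<le> real m * q" using mult_right_mono[of 1 "real m" "real q"] m1 by simp
      finally show ?thesis using mqK by simp
    qed
    show "\<bar>\<alpha>\<bar> ^ i \<le> K" if "i < degree p" for i
    proof -
      have "\<bar>\<alpha>\<bar> ^ i \<le> (real q + 1) ^ i" using bnd[of \<alpha>] by (intro power_mono) auto
      also have "\<dots> \<le> (real q + 1) ^ m" using that deg by (intro power_increasing) (auto simp: p_def)
      also have "\<dots> \<le> K" unfolding K_def using mq1 by (simp add: mult_le_cancel_right1)
      finally show ?thesis .
    qed
    show "K \<ge> 1" using mqK mq1 by simp
  qed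
  also have "\<dots> \<le> \<bar>poly G \<alpha>\<bar> * fact (2 * m) * K ^ (2 * m)"
    using mqK mq1 deg g(1)
    by (intro mult_mono power_increasing fact_mono) (auto simp: p_def intro!: mult_nonneg_nonneg)
  \<comment> \<open>Every factor becomes a power of \<open>t = 2 * q\<close> through
    \<open>n \<le> 2 ^ n \<le> t ^ n\<close> and \<open>q + 1 \<le> t\<close>: the mean value factor
    costs \<open>5 * m\<close>, the factorial \<open>4 * m\<^sup>2\<close>, the power of
    \<open>K\<close> \<open>6 * m\<^sup>2\<close>. Together they are at most
    \<open>15 * m\<^sup>2\<close>.\<close>
  also have "\<dots> \<le> (\<bar>\<alpha> - \<beta>\<bar> * t ^ (5 * m)) * t ^ (4 * m\<^sup>2) * t ^ (6 * m\<^sup>2)"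
  proof -
    have t2: "t \<ge> 2" using q1 by (simp add: t_def)
    have qt: "real q \<le> t" "real q + 1 \<le> t" using q1 by (auto simp: t_def)
    have nt: "real n \<le> t ^ n" for n
    proof -
      have "real n \<le> 2 ^ n" by (simp add: of_nat_less_two_power less_imp_le)
      also have "\<dots> \<le> t ^ n" using t2 by (intro power_mono) auto
      finally show ?thesis .
    qed
    have a: "(real q + 1) ^ m \<le> t ^ m" using qt by (intro power_mono) auto
    have "m * (m * (m * q)) * (real q + 1) ^ m = real m * (real m * (real m * q)) * (real q + 1) ^ m" by simp
    also have "\<dots> \<le> t ^ m * (t ^ m * (t ^ m * t)) * t ^ m"
      using t2 qt nt a by (intro mult_mono) (auto intro!: mult_nonneg_nonneg)
    also have "\<dots> = t ^ (m + (m + (m + 1)) + m)" by (simp only: power_add power_one_right)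
    also have "\<dots> \<le> t ^ (5 * m)" using t2 m1 by (intro power_increasing) auto
    finally have 1: "m * (m * (m * q)) * (real q + 1) ^ m \<le> t ^ (5 * m)" .
    have "fact (2 * m) \<le> real (2 * m) ^ (2 * m)"
      by (metis fact_le_power of_nat_fact of_nat_le_iff of_nat_power)
    also have "\<dots> \<le> (t ^ (2 * m)) ^ (2 * m)" by (intro power_mono nt) auto
    also have "\<dots> = t ^ (4 * m\<^sup>2)" by (simp add: power2_eq_square flip: power_mult)
    finally have 2: "fact (2 * m) \<le> t ^ (4 * m\<^sup>2)" .
    have "K \<le> t ^ m * t * t ^ m"
      unfolding K_def using t2 qt nt a by (intro mult_mono) auto
    also have "\<dots> = t ^ (m + 1 + m)" by (simp only: power_add power_one_right)
    also have "\<dots> \<le> t ^ (3 * m)" using t2 m1 by (intro power_increasing) auto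
    finally have "K ^ (2 * m) \<le> (t ^ (3 * m)) ^ (2 * m)" using mqK mq1 by (intro power_mono) auto
    also have "\<dots> = t ^ (6 * m\<^sup>2)" by (simp add: power2_eq_square flip: power_mult)
    finally have 3: "K ^ (2 * m) \<le> t ^ (6 * m\<^sup>2)" .
    have "\<bar>poly G \<alpha>\<bar> \<le> \<bar>\<alpha> - \<beta>\<bar> * t ^ (5 * m)"
      using Ga mult_left_mono[OF 1, of "\<bar>\<alpha> - \<beta>\<bar>"] by linarith
    then show ?thesis
      using 2 3 t2 mqK mq1 by (intro mult_mono) (auto intro!: mult_nonneg_nonneg)
  qed
  also have "\<dots> = \<bar>\<alpha> - \<beta>\<bar> * t ^ (5 * m + 4 * m\<^sup>2 + 6 * m\<^sup>2)"
    by (simp only: power_add mult.assoc)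
  also have "\<dots> \<le> \<bar>\<alpha> - \<beta>\<bar> * t ^ (15 * m\<^sup>2)"
    using q1 m1 by (intro mult_left_mono power_increasing) (auto simp: t_def power2_eq_square)
  finally show ?thesis by (simp add: t_def)
qed

text \<open>By symmetry the number of larger degree can take the role of \<open>\<alpha>\<close> in
  the auxiliary lemma.\<close>

lemma algebraic_separation:
  assumes alg: "algebraic \<alpha>" "algebraic \<beta>" and ne: "\<alpha> \<noteq> \<beta>"
    and deg: "degree (min_int_poly \<alpha>) \<le> m" "degree (min_int_poly \<beta>) \<le> m"
    and ht: "alg_height \<alpha> \<le> q" "alg_height \<beta> \<le> q"
  shows "1 \<le> \<bar>\<alpha> - \<beta>\<bar> * real (2 * q) ^ (15 * m\<^sup>2)"
  using algebraic_separation_aux[of \<alpha> \<beta> m q] algebraic_separation_aux[of \<beta> \<alpha> m q] assms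
  by (metis abs_minus_commute linorder_linear)

section \<open>Counting algebraic numbers of bounded degree and height\<close>

text \<open>Smaller degrees are included so that the natural numbers are among the nodes. This makes
  the set infinite and lets the functions be nonzero at every natural number, as the proof of
  transcendence requires.\<close>

definition algebraic_upto :: "nat \<Rightarrow> real set" where
  "algebraic_upto m = {\<alpha>. algebraic \<alpha> \<and> degree (min_int_poly \<alpha>) \<le> m}"

text \<open>There are \<open>(2 * q + 1) ^ (m + 1)\<close> coefficient lists with entries between
  \<open>-q\<close> and \<open>q\<close>, and each nonzero polynomial among them has at most
  \<open>m\<close> roots.\<close>

lemma algebraic_upto_bounded_height:
  shows finite_algebraic_upto: "finite {\<alpha>\<in>algebraic_upto m. alg_height \<alpha> \<le> q}" (is "finite ?A")
    and card_algebraic_upto: "card {\<alpha>\<in>algebraic_upto m. alg_height \<alpha> \<le> q} \<le> m * (2 * q + 1) ^ (m + 1)"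
proof -
  define L where "L = {xs. set xs \<subseteq> {- int q..int q} \<and> length xs = m + 1}"
  define Z where "Z xs = {x::real. poly (map_poly of_int (Poly xs)) x = 0}" for xs :: "int list"
  have finL: "finite L" unfolding L_def by (rule finite_lists_length_eq) simp
  have cardL: "card L = (2 * q + 1) ^ (m + 1)"
  proof -
    have "card {- int q..int q} = 2 * q + 1" by simp
    then show ?thesis unfolding L_def by (subst card_lists_length_eq) (simp_all only: finite_atLeastAtMost_int)
  qed
  let ?L = "{xs\<in>L. Poly xs \<noteq> 0}"
  have Z: "finite (Z xs)" "card (Z xs) \<le> m" if "xs \<in> ?L" for xs
  proof -
    have nz: "map_poly real_of_int (Poly xs) \<noteq> 0" using that by simp
    then show "finite (Z xs)" unfolding Z_def by (rule poly_roots_finite)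
    have "card (Z xs) \<le> degree (map_poly real_of_int (Poly xs))"
      unfolding Z_def by (rule card_poly_roots_bound[OF nz])
    also have "\<dots> = degree (Poly xs)" by simp
    also have "\<dots> \<le> m"
    proof (rule degree_le, clarify)
      fix i assume "m < i"
      then show "coeff (Poly xs) i = 0" using that by (simp add: L_def coeff_Poly_eq nth_default_def)
    qed
    finally show "card (Z xs) \<le> m" .
  qed
  have sub: "?A \<subseteq> (\<Union>xs\<in>?L. Z xs)"
  proof
    fix \<alpha> assume "\<alpha> \<in> ?A"
    then have \<alpha>: "algebraic \<alpha>" "degree (min_int_poly \<alpha>) \<le> m" "alg_height \<alpha> \<le> q"
      by (auto simp: algebraic_upto_def)
    define p where "p = min_int_poly \<alpha>"
    have p: "p \<noteq> 0" "poly (map_poly of_int p) \<alpha> = 0"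
      using is_min_int_poly_min_int_poly[OF \<alpha>(1)] by (auto simp: p_def is_min_int_poly_def)
    \<comment> \<open>Padding with zeros gives all lists the length \<open>m + 1\<close>;
      \<open>Poly\<close> ignores them.\<close>
    define xs where "xs = map (coeff p) [0..<m+1]"
    have "Poly xs = p"
      using \<alpha>(2) by (intro poly_eqI) (auto simp: xs_def coeff_Poly_eq nth_default_def p_def coeff_eq_0 simp del: upt_Suc)
    moreover have "\<bar>coeff p i\<bar> \<le> int q" for i
      using abs_coeff_min_int_poly_le[of \<alpha> i] \<alpha>(3) by (simp add: p_def)
    then have "xs \<in> L" by (auto simp: xs_def L_def abs_le_iff minus_le_iff)
    ultimately show "\<alpha> \<in> (\<Union>xs\<in>?L. Z xs)" using p by (auto simp: Z_def)
  qed
  have finU: "finite (\<Union>xs\<in>?L. Z xs)" using finL Z by auto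
  then show "finite ?A" using sub finite_subset by blast
  have "card ?A \<le> card (\<Union>xs\<in>?L. Z xs)" using finU sub by (rule card_mono)
  also have "\<dots> \<le> (\<Sum>xs\<in>?L. card (Z xs))" using finL by (intro card_UN_le) auto
  also have "\<dots> \<le> (\<Sum>xs\<in>?L. m)" by (intro sum_mono Z)
  also have "\<dots> = card ?L * m" by simp
  also have "\<dots> \<le> card L * m" by (intro mult_right_mono card_mono finL) auto
  finally show "card ?A \<le> m * (2 * q + 1) ^ (m + 1)" by (simp only: cardL mult.commute)
qed

lemma nat_in_algebraic_upto:
  assumes "m \<ge> 1"
  shows "real n \<in> algebraic_upto m"
proof -
  have alg: "algebraic (real n)" by simp
  have "poly (map_poly real_of_int [:- int n, 1:]) (real n) = 0" "[:- int n, 1:] \<noteq> 0"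
    by (auto simp: map_poly_pCons)
  then have "degree (min_int_poly (real n)) \<le> degree [:- int n, 1:]"
    using is_min_int_poly_min_int_poly[OF alg] unfolding is_min_int_poly_def by blast
  then show ?thesis using alg assms by (simp add: algebraic_upto_def)
qed

lemma infinite_algebraic_upto:
  assumes "m \<ge> 1"
  shows "infinite (algebraic_upto m)"
proof
  assume "finite (algebraic_upto m)"
  moreover have "range real \<subseteq> algebraic_upto m" using nat_in_algebraic_upto[OF assms] by auto
  ultimately have "finite (range real)" by (rule finite_subset[rotated])
  then show False by (simp add: finite_image_iff inj_on_def)
qed

section \<open>Coefficients with rational sums\<close>

text \<open>The choice is greedy: \<open>a n\<close> has least height among the elements not yet
  taken. An element never reached would bound the heights of all the infinitely many chosen ones,
  against the finiteness of the sublevel sets.\<close>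

lemma rank_enumeration:
  fixes ht :: "'a \<Rightarrow> nat"
  assumes inf: "infinite B" and fin: "\<And>q. finite {x\<in>B. ht x \<le> q}"
  obtains a :: "nat \<Rightarrow> 'a" where "bij_betw a UNIV B" "\<And>k n. k \<le> n \<Longrightarrow> ht (a k) \<le> ht (a n)"
proof -
  let ?P = "\<lambda>f n x. x \<in> B - f ` {..<n} \<and> (\<forall>y \<in> B - f ` {..<n}. ht x \<le> ht y)"
  have "\<exists>a. \<forall>n::nat. ?P a n (a n)"
  proof (rule dependent_wf_choice[of less_than])
    show "wf less_than" by simp
    show "?P f n r = ?P g n r" if "\<And>k. (k, n) \<in> less_than \<Longrightarrow> f k = g k" for f g :: "nat \<Rightarrow> 'a" and n r
    proof -
      have "f ` {..<n} = g ` {..<n}" using that by auto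
      then show ?thesis by simp
    qed
    show "\<exists>r. ?P f n r" for f :: "nat \<Rightarrow> 'a" and n
    proof -
      have "infinite (B - f ` {..<n})" using inf by (intro Diff_infinite_finite) auto
      then obtain x where "x \<in> B - f ` {..<n}" by (metis ex_in_conv finite.emptyI)
      then show ?thesis
        using ex_has_least_nat[of "\<lambda>x. x \<in> B - f ` {..<n}" x ht] by auto
    qed
  qed
  then obtain a where "\<forall>n::nat. ?P a n (a n)" ..
  then have aB: "a n \<in> B" and anew: "a n \<notin> a ` {..<n}"
    and amin: "\<And>y. y \<in> B \<Longrightarrow> y \<notin> a ` {..<n} \<Longrightarrow> ht (a n) \<le> ht y" for n
    by (auto simp del: lessThan_iff)
  have inj: "inj a"
  proof (rule linorder_injI)
    fix k n :: nat assume "k < n"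
    then show "a k \<noteq> a n" using anew[of n] by (metis imageI lessThan_iff)
  qed
  have mono: "ht (a k) \<le> ht (a n)" if "k \<le> n" for k n
  proof (rule amin[OF aB])
    show "a n \<notin> a ` {..<k}" using anew[of n] that
      by (metis (no_types, lifting) image_mono lessThan_subset_iff subsetD)
  qed
  have "x \<in> range a" if x: "x \<in> B" for x
  proof (rule ccontr)
    assume "x \<notin> range a"
    then have "range a \<subseteq> {y\<in>B. ht y \<le> ht x}" using aB amin[OF x] by blast
    then have "finite (range a)" using fin finite_subset by blast
    then show False using inj by (simp add: finite_image_iff)
  qed
  then have "bij_betw a UNIV B" using aB inj by (auto simp: bij_betw_def)
  then show ?thesis using mono that by blast
qed

text \<open>Stepping past \<open>x\<close> in the direction away from 0 excludes the value 0, and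
  the two step lengths give two different integers close to \<open>x\<close>, one for each value of
  the flag.\<close>

definition round_away :: "bool \<Rightarrow> real \<Rightarrow> int" where
  "round_away b x = (if x \<ge> 0 then \<lfloor>x\<rfloor> + (if b then 1 else 2) else \<lceil>x\<rceil> - (if b then 1 else 2))"

lemma round_away:
  "round_away b x \<noteq> 0" "\<bar>of_int (round_away b x) - x\<bar> \<le> 2"
  "round_away b x = round_away b' x \<longleftrightarrow> b = b'"
proof -
  show "round_away b x \<noteq> 0" unfolding round_away_def by (auto split: if_splits) (linarith+)?
  show "\<bar>of_int (round_away b x) - x\<bar> \<le> 2" unfolding round_away_def by (auto split: if_splits) linarith+
  show "round_away b x = round_away b' x \<longleftrightarrow> b = b'" by (auto simp: round_away_def)
qed

text \<open>
  The system \<open>\<Sum>\<^sub>k\<^sub>\<le>\<^sub>n c\<^sub>k w k n = r\<^sub>n / D n\<close> is triangular, so \<open>c\<^sub>n\<close> can be solved for after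
  \<open>r\<^sub>n\<close> has been taken to be one of two integers; \<open>s\<close> is the set of steps where the first is taken.
\<close>

context
  fixes w :: "nat \<Rightarrow> nat \<Rightarrow> real" and D :: "nat \<Rightarrow> nat" and s :: "nat set"
begin

context
  notes sum.cong[fundef_cong]
begin

function interp_coeff :: "nat \<Rightarrow> real" where
  "interp_coeff n = (of_int (round_away (n \<in> s) (D n * (\<Sum>k<n. interp_coeff k * w k n))) / D n
      - (\<Sum>k<n. interp_coeff k * w k n)) / w n n"
  by pat_completeness auto
termination by (relation less_than) auto

end

end

declare interp_coeff.simps [simp del]

text \<open>Multiplied by \<open>D n * w n n\<close>, the coefficient is just a rounding error, at
  most 2. The sizes of the earlier coefficients therefore do not accumulate.\<close>

lemma interp_coeff_bound:
  assumes "D n > 0"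
  shows "\<bar>interp_coeff w D s n\<bar> \<le> 2 / (D n * \<bar>w n n\<bar>)"
proof -
  let ?x = "\<Sum>k<n. interp_coeff w D s k * w k n"
  have "interp_coeff w D s n = (of_int (round_away (n \<in> s) (D n * ?x)) - D n * ?x) / (D n * w n n)"
    using assms by (subst interp_coeff.simps) (simp add: diff_divide_eq_iff divide_diff_eq_iff mult.commute)
  then show ?thesis
    using round_away(2)[of "n \<in> s" "D n * ?x"] by (simp add: abs_mult divide_right_mono)
qed

lemma interp_coeff_sum:
  assumes "w n n \<noteq> 0"
  shows "(\<Sum>k\<le>n. interp_coeff w D s k * w k n) =
    of_int (round_away (n \<in> s) (D n * (\<Sum>k<n. interp_coeff w D s k * w k n))) / D n"
  using assms by (subst lessThan_Suc_atMost[symmetric], subst sum.lessThan_Suc, subst (2) interp_coeff.simps) simp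

text \<open>Strong induction: equal earlier coefficients mean that the same number is rounded at
  step \<open>n\<close>, so the equal results reveal the same choice and hence the same next
  coefficient.\<close>

lemma interp_coeff_inj:
  assumes D: "\<And>n. D n > 0" and w: "\<And>n. w n n \<noteq> 0"
    and eq: "\<And>n. (\<Sum>k\<le>n. interp_coeff w D s k * w k n) = (\<Sum>k\<le>n. interp_coeff w D s' k * w k n)"
  shows "s = s'"
proof -
  have "interp_coeff w D s n = interp_coeff w D s' n \<and> (n \<in> s \<longleftrightarrow> n \<in> s')" for n
  proof (induction n rule: less_induct)
    case (less n)
    then have *: "(\<Sum>k<n. interp_coeff w D s k * w k n) = (\<Sum>k<n. interp_coeff w D s' k * w k n)"
      by (intro sum.cong) auto
    have "n \<in> s \<longleftrightarrow> n \<in> s'"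
      using eq[of n] D[of n] interp_coeff_sum[where w = w and D = D and s = s, OF w]
        interp_coeff_sum[where w = w and D = D and s = s', OF w] *
      by (simp add: round_away)
    with * show ?case by (subst (1 2) interp_coeff.simps) simp
  qed
  then show ?thesis by blast
qed

section \<open>Analyticity and transcendence\<close>

lemma uncountable_nat_set: "uncountable (UNIV :: nat set set)"
proof
  assume "countable (UNIV :: nat set set)"
  then obtain f :: "nat \<Rightarrow> nat set" where "range f = UNIV"
    by (metis UNIV_not_empty range_from_nat_into)
  then show False using Cantors_theorem[of "UNIV :: nat set"] by auto
qed

lemma tendsto_mult_poly_rapid_decay:
  fixes y :: "nat \<Rightarrow> complex"
  assumes "\<And>k. (\<lambda>n. y n * of_nat n ^ k) \<longlonglongrightarrow> 0"
  shows "(\<lambda>n. y n * poly p (of_nat n)) \<longlonglongrightarrow> 0"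
proof -
  have "(\<lambda>n. \<Sum>i\<le>degree p. coeff p i * (y n * of_nat n ^ i)) \<longlonglongrightarrow> (\<Sum>i\<le>degree p. coeff p i * 0)"
    by (intro tendsto_intros assms)
  then show ?thesis by (simp add: poly_altdef sum_distrib_left mult_ac)
qed

text \<open>Induction along Horner's scheme in the second variable, \<open>P = p + y * R\<close>;
  the extra factor \<open>y n\<close> tames the polynomial \<open>p\<close> in
  \<open>n\<close>.\<close>

lemma tendsto_mult_poly2_rapid_decay:
  fixes y :: "nat \<Rightarrow> complex"
  assumes y: "\<And>k. (\<lambda>n. y n * of_nat n ^ k) \<longlonglongrightarrow> 0"
  shows "(\<lambda>n. y n * poly2 P (of_nat n) (y n)) \<longlonglongrightarrow> 0"
proof (induction P)
  case 0
  then show ?case by (simp add: poly2_def)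
next
  case (pCons p P)
  have "y \<longlonglongrightarrow> 0" using y[of 0] by simp
  then have "(\<lambda>n. y n * poly p (of_nat n) + y n * (y n * poly2 P (of_nat n) (y n))) \<longlonglongrightarrow> 0 + 0 * 0"
    by (intro tendsto_intros tendsto_mult_poly_rapid_decay y pCons.IH)
  then show ?case by (simp add: poly2_def algebra_simps)
qed

text \<open>Subtracting the constant term and dividing by \<open>n\<close> leaves the lower degree
  polynomial, which also tends to 0 and so is zero by induction; what remains is a constant sequence
  with limit 0.\<close>

lemma poly_nat_tendsto_0_imp_eq_0:
  fixes p :: "complex poly"
  assumes "(\<lambda>n. poly p (of_nat n)) \<longlonglongrightarrow> 0"
  shows "p = 0"
  using assms
proof (induction p)
  case (pCons a p)
  have inv: "(\<lambda>n. 1 / (of_nat n :: complex)) \<longlonglongrightarrow> 0"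
    by (rule lim_1_over_n)
  have "(\<lambda>n. (poly (pCons a p) (of_nat n) - a) * (1 / of_nat n)) \<longlonglongrightarrow> (0 - a) * 0"
    by (intro tendsto_mult tendsto_diff tendsto_const inv pCons.prems)
  moreover have "eventually (\<lambda>n. (poly (pCons a p) (of_nat n) - a) * (1 / of_nat n) = poly p (of_nat n)) sequentially"
    using eventually_gt_at_top[of 0] by eventually_elim simp
  ultimately have "(\<lambda>n. poly p (of_nat n)) \<longlonglongrightarrow> 0"
    by (simp add: tendsto_cong)
  then have "p = 0" by (rule pCons.IH)
  with pCons.prems show ?case by (simp add: LIMSEQ_const_iff)
qed simp

text \<open>Divide a nonzero \<open>P\<close> by the largest possible power of \<open>y\<close>. As
  \<open>f\<close> is nonzero at the naturals, the quotient \<open>Q = p + y * R\<close> still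
  vanishes along them, so \<open>p\<close> tends to 0 there and must be zero, although
  \<open>y\<close> does not divide \<open>Q\<close>.\<close>

lemma transcendental_fun_rapid_decay:
  assumes decay: "\<And>k. (\<lambda>n. f (real n) * real n ^ k) \<longlonglongrightarrow> 0" and nz: "\<And>n. f (real n) \<noteq> 0"
  shows "transcendental_fun f"
  unfolding transcendental_fun_def
proof (intro allI impI, rule ccontr)
  fix P
  assume P: "\<forall>x. poly2 P (complex_of_real x) (complex_of_real (f x)) = 0" and "P \<noteq> 0"
  define y where "y n = complex_of_real (f (real n))" for n
  have y: "(\<lambda>n. y n * of_nat n ^ k) \<longlonglongrightarrow> 0" for k
    using tendsto_of_real[OF decay[of k], where 'a = complex] by (simp add: y_def)
  obtain Q where Q: "P = [:- 0, 1:] ^ Polynomial.order 0 P * Q" "\<not> [:- 0, 1:] dvd Q"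
    using order_decomp[OF \<open>P \<noteq> 0\<close>, of 0] by blast
  obtain p R where R: "Q = pCons p R" by (cases Q)
  have "p \<noteq> 0" using Q(2) R by (auto simp: dvd_def)
  moreover have "poly p (of_nat n) = - (y n * poly2 R (of_nat n) (y n))" for n
  proof -
    have "poly2 P (of_nat n) (y n) = 0" using P by (metis of_real_of_nat_eq y_def)
    then have "y n ^ Polynomial.order 0 P * poly2 Q (of_nat n) (y n) = 0"
      by (subst (asm) Q(1)) (simp add: poly2_def poly_power)
    then have "poly2 Q (of_nat n) (y n) = 0" using nz[of n] by (simp add: y_def)
    then show ?thesis by (simp add: R poly2_def eq_neg_iff_add_eq_0)
  qed
  then have "(\<lambda>n. poly p (of_nat n)) \<longlonglongrightarrow> 0"
    using tendsto_minus[OF tendsto_mult_poly2_rapid_decay[OF y, of R]] by simp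
  ultimately show False using poly_nat_tendsto_0_imp_eq_0 by blast
qed

text \<open>Powers of a real \<open>h\<close> are real, so the real parts of the complex Taylor
  coefficients expand the real part of \<open>g\<close>. The radius of convergence does not shrink,
  since convergence at a real point survives taking real parts.\<close>

lemma real_analytic_Re:
  assumes g: "g holomorphic_on S" and S: "open S" "range complex_of_real \<subseteq> S"
  shows "real_analytic (\<lambda>x. Re (g (complex_of_real x)))"
  unfolding real_analytic_def
proof
  fix a :: real
  have "g analytic_on {complex_of_real a}"
    using S g unfolding analytic_at by blast
  then have F: "(\<lambda>x. g (complex_of_real a + x)) has_fps_expansion fps_expansion g (complex_of_real a)"
    by (rule analytic_at_imp_has_fps_expansion)
  define F where "F = fps_expansion g (complex_of_real a)"
  define R where "R = Abs_fps (\<lambda>n. Re (fps_nth F n))"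
  have cr: "fps_conv_radius F > 0" and ev: "eventually (\<lambda>z. eval_fps F z = g (complex_of_real a + z)) (nhds 0)"
    using F by (auto simp: has_fps_expansion_def F_def)
  have le: "fps_conv_radius F \<le> fps_conv_radius R"
    unfolding fps_conv_radius_def[of R]
  proof (rule conv_radius_geI_ex)
    fix r :: real assume r: "0 < r" "ereal r < fps_conv_radius F"
    have "summable (\<lambda>n. fps_nth F n * complex_of_real r ^ n)"
      using r by (intro summable_fps) simp
    then have "summable (\<lambda>n. Re (fps_nth F n * complex_of_real r ^ n))"
      by (rule summable_Re)
    then have "summable (\<lambda>n. fps_nth R n * r ^ n)"
      by (simp add: R_def flip: of_real_power)
    then show "\<exists>z. norm z = r \<and> summable (\<lambda>n. fps_nth R n * z ^ n)"
      using r by (intro exI[of _ r]) auto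
  qed
  have "filterlim complex_of_real (nhds 0) (nhds 0)"
    using tendsto_of_real[OF filterlim_ident, where 'a = complex, of "0::real"] by simp
  then have ev': "eventually (\<lambda>h::real. eval_fps F (complex_of_real h) = g (complex_of_real a + complex_of_real h)) (nhds 0)"
    using ev by (rule eventually_compose_filterlim[rotated])
  have "eventually (\<lambda>h::real. h \<in> eball 0 (fps_conv_radius F)) (nhds 0)"
    using cr by (intro eventually_nhds_in_open) (auto simp: zero_ereal_def)
  with ev' have "eventually (\<lambda>h. eval_fps R h = Re (g (complex_of_real (a + h)))) (nhds 0)"
  proof eventually_elim
    case (elim h)
    have "summable (\<lambda>n. fps_nth F n * complex_of_real h ^ n)"
      using elim(2) by (intro summable_fps) simp
    then have "(\<lambda>n. fps_nth F n * complex_of_real h ^ n) sums eval_fps F (complex_of_real h)"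
      by (simp add: eval_fps_def summable_sums)
    then have "(\<lambda>n. Re (fps_nth F n * complex_of_real h ^ n)) sums Re (eval_fps F (complex_of_real h))"
      by (rule sums_Re)
    then have "(\<lambda>n. fps_nth R n * h ^ n) sums Re (eval_fps F (complex_of_real h))"
      by (simp add: R_def flip: of_real_power)
    then show ?case using elim(1) by (simp add: eval_fps_def sums_iff)
  qed
  then show "\<exists>F. (\<lambda>h. Re (g (complex_of_real (a + h)))) has_fps_expansion F"
    using cr le by (auto simp: has_fps_expansion_def intro!: exI[of _ R])
qed

section \<open>The interpolating series\<close>

text \<open>A simple zero at 0 as for the plain factor \<open>z\<close>, but bounded near the real
  axis; the only poles are \<open>\<i>\<close> and \<open>- \<i>\<close>.\<close>

definition bump :: "'a::real_normed_field \<Rightarrow> 'a" where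
  "bump z = z / (1 + z\<^sup>2)"

text \<open>The zeros at the earlier nodes make the interpolation triangular, and the Gaussian
  supplies the decay. The type is generic because values at nodes are taken over the reals and
  analyticity over the complex numbers.\<close>

definition basis_fun :: "(nat \<Rightarrow> real) \<Rightarrow> nat \<Rightarrow> 'a::{banach,real_normed_field} \<Rightarrow> 'a" where
  "basis_fun a n z = exp (- (z\<^sup>2)) * (\<Prod>k<n. bump (z - of_real (a k)))"

lemma basis_fun_of_real: "basis_fun a n (complex_of_real x) = complex_of_real (basis_fun a n x)"
  by (simp add: basis_fun_def bump_def flip: exp_of_real)

lemma basis_fun_eq_0: "k < n \<Longrightarrow> basis_fun a n (a k) = 0"
  by (auto simp: basis_fun_def bump_def)

definition strip :: "complex set" where "strip = {z. \<bar>Im z\<bar> < 1/2}"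

lemma strip_dist_i:
  assumes "z \<in> strip"
  shows "norm (z - \<i>) \<ge> 1/2" "norm (z + \<i>) \<ge> 1/2"
  using assms abs_Im_le_cmod[of "z - \<i>"] abs_Im_le_cmod[of "z + \<i>"] by (auto simp: strip_def)

lemma strip_one_plus_square: "1 + z\<^sup>2 = (z - \<i>) * (z + \<i>)"
  by (simp add: algebra_simps power2_eq_square)

lemma strip_denom_nonzero: "z \<in> strip \<Longrightarrow> 1 + z\<^sup>2 \<noteq> 0"
  using strip_dist_i[of z] by (auto simp: strip_one_plus_square)

text \<open>By partial fractions \<open>bump z\<close> is the mean of \<open>1 / (z - \<i>)\<close>
  and \<open>1 / (z + \<i>)\<close>, and the strip stays at distance at least 1/2 from both
  poles.\<close>

lemma norm_bump_le:
  assumes "z \<in> strip"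
  shows "norm (bump z) \<le> 2"
proof -
  note d = strip_dist_i[OF assms]
  have nz: "z - \<i> \<noteq> 0" "z + \<i> \<noteq> 0" using d by auto
  have "bump z = (1 / (z - \<i>) + 1 / (z + \<i>)) / 2"
    unfolding bump_def strip_one_plus_square add_frac_eq[OF nz] by simp
  also have "norm \<dots> \<le> (norm (1 / (z - \<i>)) + norm (1 / (z + \<i>))) / 2"
    unfolding norm_divide[of _ 2] by (simp add: divide_right_mono norm_triangle_ineq del: norm_divide)
  also have "\<dots> \<le> (2 + 2) / 2"
    using d nz by (intro divide_right_mono add_mono) (auto simp: norm_divide field_simps)
  finally show ?thesis by simp
qed

lemma strip_diff_real: "z \<in> strip \<Longrightarrow> z - complex_of_real x \<in> strip"
  by (simp add: strip_def)

lemma open_strip: "open strip"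
  unfolding strip_def by (intro open_Collect_less continuous_intros)

lemma of_real_in_strip: "complex_of_real x \<in> strip"
  by (simp add: strip_def)

lemma norm_basis_fun_le_exp:
  assumes "z \<in> strip"
  shows "norm (basis_fun a n z) \<le> norm (exp (- (z\<^sup>2))) * 2 ^ n"
proof -
  have "(\<Prod>k<n. norm (bump (z - complex_of_real (a k)))) \<le> (\<Prod>k<n. 2)"
    by (intro prod_mono conjI norm_bump_le strip_diff_real assms) auto
  then show ?thesis by (simp add: basis_fun_def norm_mult prod_norm mult_left_mono)
qed

text \<open>On the strip the Gaussian has norm at most
  \<open>exp ((Im z)\<^sup>2) \<le> exp (1/4) \<le> 2\<close>.\<close>

lemma norm_basis_fun_le:
  assumes "z \<in> strip"
  shows "norm (basis_fun a n z) \<le> 2 * 2 ^ n"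
proof -
  have "(Im z)\<^sup>2 \<le> (1/2)\<^sup>2"
    using assms by (intro abs_le_square_iff[THEN iffD1]) (auto simp: strip_def)
  moreover have "Re (- (z\<^sup>2)) = (Im z)\<^sup>2 - (Re z)\<^sup>2" by (simp add: power2_eq_square)
  moreover have "(Re z)\<^sup>2 \<ge> 0" "(1/2 :: real)\<^sup>2 = 1/4" by (simp_all add: power2_eq_square)
  ultimately have "Re (- (z\<^sup>2)) \<le> 1/4" by linarith
  then have "norm (exp (- (z\<^sup>2))) \<le> exp (1/4)" by simp
  also have "\<dots> \<le> 2"
    using exp_bound[of "1/4"] by (simp add: power2_eq_square)
  finally have "norm (exp (- (z\<^sup>2))) * 2 ^ n \<le> 2 * 2 ^ n" by (intro mult_right_mono) auto
  then show ?thesis by (rule order.trans[OF norm_basis_fun_le_exp[OF assms]])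
qed

lemma holomorphic_basis_fun: "basis_fun a n holomorphic_on strip"
  unfolding basis_fun_def bump_def
  by (intro holomorphic_intros) (use strip_denom_nonzero strip_diff_real in blast)

context
  fixes a c :: "nat \<Rightarrow> real"
begin

definition series_fun :: "complex \<Rightarrow> complex" where
  "series_fun z = (\<Sum>n. complex_of_real (c n) * basis_fun a n z)"

definition real_series :: "real \<Rightarrow> real" where
  "real_series x = Re (series_fun (complex_of_real x))"

context
  assumes c: "\<And>n. \<bar>c n\<bar> \<le> 1 / (10^6 * 4 ^ n)"
begin

text \<open>The decay \<open>4 ^ n\<close> of the coefficients beats the growth \<open>2 ^ n\<close>
  of the basis functions and leaves a geometric series of ratio 1/2.\<close>

lemma norm_series_term_le:
  assumes "z \<in> strip"
  shows "norm (complex_of_real (c n) * basis_fun a n z) \<le> 2 / 10^6 * (1/2) ^ n"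
proof -
  have "norm (complex_of_real (c n) * basis_fun a n z) \<le> (1 / (10^6 * 4 ^ n)) * (2 * 2 ^ n)"
    unfolding norm_mult using c by (intro mult_mono norm_basis_fun_le assms) auto
  also have "\<dots> = 2 / 10^6 * (1/2) ^ n"
  proof -
    have "(4::real) ^ n = 2 ^ n * 2 ^ n" by (simp flip: power_mult_distrib)
    then show ?thesis by (simp add: field_simps)
  qed
  finally show ?thesis .
qed

lemma summable_series_terms: "z \<in> strip \<Longrightarrow> summable (\<lambda>n. complex_of_real (c n) * basis_fun a n z)"
  by (rule summable_comparison_test'[OF _ norm_series_term_le]) (auto intro!: summable_mult summable_geometric)

lemma holomorphic_series_fun: "series_fun holomorphic_on strip"
proof (rule holomorphic_uniform_sequence[OF open_strip])
  show "(\<lambda>z. \<Sum>i<n. complex_of_real (c i) * basis_fun a i z) holomorphic_on strip" for n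
    by (intro holomorphic_intros holomorphic_basis_fun)
  have "uniform_limit strip (\<lambda>n z. \<Sum>i<n. complex_of_real (c i) * basis_fun a i z) series_fun sequentially"
    unfolding series_fun_def
    by (rule Weierstrass_m_test[OF norm_series_term_le]) (auto intro!: summable_mult summable_geometric)
  then show "\<exists>d>0. cball x d \<subseteq> strip \<and>
      uniform_limit (cball x d) (\<lambda>n z. \<Sum>i<n. complex_of_real (c i) * basis_fun a i z) series_fun sequentially"
    if "x \<in> strip" for x
    using that open_strip by (meson open_contains_cball uniform_limit_on_subset)
qed

lemma norm_series_fun_le:
  assumes "z \<in> strip"
  shows "norm (series_fun z) \<le> 4 / 10^6"
proof -
  have "norm (series_fun z) \<le> (\<Sum>n. 2 / 10^6 * (1/2) ^ n)"
    unfolding series_fun_def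
    by (rule norm_suminf_le[OF norm_series_term_le[OF assms]]) (auto intro!: summable_mult summable_geometric)
  also have "\<dots> = 4 / 10^6"
    by (subst suminf_mult) (auto simp: suminf_geometric intro!: summable_geometric)
  finally show ?thesis .
qed

lemma real_series_deriv: "\<bar>deriv real_series x\<bar> < 0.0001"
proof -
  have "(series_fun has_field_derivative deriv series_fun x) (at (complex_of_real x))"
    using holomorphic_derivI[OF holomorphic_series_fun open_strip of_real_in_strip] by simp
  then have "((\<lambda>x. series_fun (complex_of_real x)) has_vector_derivative deriv series_fun x) (at x)"
    by (rule has_vector_derivative_real_field)
  then have "(real_series has_vector_derivative Re (deriv series_fun x)) (at x)"
    unfolding real_series_def [abs_def]
    by (rule bounded_linear.has_vector_derivative[OF bounded_linear_Re])
  then have "deriv real_series x = Re (deriv series_fun x)"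
    by (simp add: DERIV_imp_deriv has_real_derivative_iff_has_vector_derivative)
  \<comment> \<open>A disc of radius 1/4 about a real point stays inside the strip, and
    \<open>4 * (4 / 10^6)\<close> is below \<open>0.0001\<close>.\<close>
  moreover have "norm ((deriv ^^ 1) series_fun x) \<le> fact 1 * (4 / 10^6) / (1/4) ^ 1"
  proof (rule Cauchy_inequality)
    have sub: "cball (complex_of_real x) (1/4) \<subseteq> strip"
    proof
      fix z assume "z \<in> cball (complex_of_real x) (1/4)"
      then have "\<bar>Im (complex_of_real x - z)\<bar> \<le> 1/4"
        using abs_Im_le_cmod[of "complex_of_real x - z"] by (simp add: dist_norm del: minus_complex.sel)
      then show "z \<in> strip" by (simp add: strip_def)
    qed
    then have hol: "series_fun holomorphic_on cball (complex_of_real x) (1/4)"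
      using holomorphic_series_fun holomorphic_on_subset by blast
    then show "continuous_on (cball (complex_of_real x) (1/4)) series_fun"
      by (rule holomorphic_on_imp_continuous_on)
    show "series_fun holomorphic_on ball (complex_of_real x) (1/4)"
      using hol ball_subset_cball holomorphic_on_subset by blast
    show "norm (series_fun z) \<le> 4 / 10^6" if "norm (complex_of_real x - z) = 1/4" for z
      using that sub by (intro norm_series_fun_le) (auto simp: dist_norm)
  qed auto
  ultimately show ?thesis
    using abs_Re_le_cmod[of "deriv series_fun x"] by simp
qed

lemma real_series_sums: "(\<lambda>n. c n * basis_fun a n x) sums real_series x"
proof -
  have "(\<lambda>n. Re (complex_of_real (c n) * basis_fun a n (complex_of_real x))) sums real_series x"
    unfolding real_series_def series_fun_def
    by (intro sums_Re summable_sums summable_series_terms of_real_in_strip)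
  then show ?thesis by (simp add: basis_fun_of_real)
qed

lemma real_series_at_node: "real_series (a n) = (\<Sum>k\<le>n. c k * basis_fun a k (a n))"
proof -
  have "(\<lambda>k. c k * basis_fun a k (a n)) sums (\<Sum>k\<le>n. c k * basis_fun a k (a n))"
    by (rule sums_finite) (auto simp: basis_fun_eq_0)
  with real_series_sums show ?thesis by (rule sums_unique2)
qed

text \<open>The Gaussian is common to all terms and is kept as a factor; the remaining series sums
  to at most \<open>2 / 10^6\<close>.\<close>

lemma abs_real_series_le: "\<bar>real_series x\<bar> \<le> exp (- (x\<^sup>2))"
proof -
  have t: "norm (c n * basis_fun a n x) \<le> exp (- (x\<^sup>2)) / 10^6 * (1/2) ^ n" for n
  proof -
    have "\<bar>basis_fun a n x\<bar> \<le> exp (- (x\<^sup>2)) * 2 ^ n"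
      using norm_basis_fun_le_exp[OF of_real_in_strip[of x], of a n]
      by (simp add: basis_fun_of_real flip: exp_of_real of_real_power)
    then have "norm (c n * basis_fun a n x) \<le> (1 / (10^6 * 4 ^ n)) * (exp (- (x\<^sup>2)) * 2 ^ n)"
      unfolding real_norm_def abs_mult using c by (intro mult_mono) auto
    also have "\<dots> = exp (- (x\<^sup>2)) / 10^6 * (1/2) ^ n"
    proof -
      have "(4::real) ^ n = 2 ^ n * 2 ^ n" by (simp flip: power_mult_distrib)
      then show ?thesis by (simp add: field_simps)
    qed
    finally show ?thesis .
  qed
  have "norm (\<Sum>n. c n * basis_fun a n x) \<le> (\<Sum>n. exp (- (x\<^sup>2)) / 10^6 * (1/2) ^ n)"
    by (rule norm_suminf_le[OF t]) (auto intro!: summable_mult summable_geometric)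
  also have "\<dots> = exp (- (x\<^sup>2)) / 10^6 * 2"
    by (subst suminf_mult) (auto simp: suminf_geometric intro!: summable_geometric)
  also have "\<dots> \<le> exp (- (x\<^sup>2))" by simp
  finally show ?thesis using real_series_sums[of x] by (simp add: sums_iff)
qed

lemma real_series_rapid_decay: "(\<lambda>n. real_series (real n) * real n ^ k) \<longlonglongrightarrow> 0"
proof (rule tendsto_0_le)
  show "(\<lambda>n. exp (- ((real n)\<^sup>2)) * real n ^ k) \<longlonglongrightarrow> 0" by real_asymp
  show "eventually (\<lambda>n. norm (real_series (real n) * real n ^ k)
      \<le> norm (exp (- ((real n)\<^sup>2)) * real n ^ k) * 1) sequentially"
    using abs_real_series_le by (auto simp: abs_mult intro!: always_eventually mult_right_mono)
qed

end

end

section \<open>Lower bounds at the nodes and the size of the denominators\<close>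

text \<open>For \<open>y = \<bar>x - a k\<bar>\<close> both 1 and \<open>y\<^sup>2\<close> are at
  most \<open>y * T\<close>, so each factor \<open>y / (1 + y\<^sup>2)\<close> is at least
  \<open>1 / (2 * T)\<close>.\<close>

lemma abs_basis_fun_node_ge:
  fixes x T :: real
  assumes far: "\<And>k. k < n \<Longrightarrow> 1 \<le> \<bar>x - a k\<bar> * T" and near: "\<And>k. k < n \<Longrightarrow> \<bar>x - a k\<bar> \<le> T" and T: "T \<ge> 1"
  shows "exp (- (x\<^sup>2)) \<le> \<bar>basis_fun a n x\<bar> * (2 * T) ^ n"
proof -
  have b: "1 \<le> \<bar>bump (x - a k)\<bar> * (2 * T)" if k: "k < n" for k
  proof -
    define y where "y = \<bar>x - a k\<bar>"
    have y: "1 \<le> y * T" "y \<le> T" "y \<ge> 0" using far[OF k] near[OF k] by (auto simp: y_def)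
    have "y * y \<le> y * T" using y by (intro mult_left_mono)
    then have "1 + y\<^sup>2 \<le> y * (2 * T)" using y by (simp add: power2_eq_square)
    moreover have "1 + y\<^sup>2 > 0" using zero_le_power2[of y] by linarith
    ultimately have "1 \<le> y / (1 + y\<^sup>2) * (2 * T)" by (simp add: field_simps)
    moreover have "\<bar>bump (x - a k)\<bar> = y / (1 + y\<^sup>2)"
      using \<open>1 + y\<^sup>2 > 0\<close> by (simp add: bump_def y_def)
    ultimately show ?thesis by simp
  qed
  have "exp (- (x\<^sup>2)) * 1 \<le> exp (- (x\<^sup>2)) * (\<Prod>k<n. \<bar>bump (x - a k)\<bar> * (2 * T))"
    by (intro mult_left_mono prod_ge_1 b) auto
  also have "\<dots> = \<bar>basis_fun a n x\<bar> * (2 * T) ^ n"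
    by (simp add: basis_fun_def abs_mult abs_prod prod.distrib)
  finally show ?thesis by simp
qed

lemma den_int_divide_le:
  assumes "d > 0"
  shows "den (of_int r / real d) \<le> d"
proof -
  have "of_int r / real d = of_rat (Rat.Fract r (int d))"
    using assms by (simp add: of_rat_rat)
  then have "den (of_int r / real d) = nat (snd (quotient_of (Rat.Fract r (int d))))"
    by (simp add: den_of_rat)
  also have "\<dots> = nat (int d div gcd r (int d))"
    using assms by (simp add: quotient_of_Fract Rat.normalize_def Let_def)
  also have "int d div gcd r (int d) \<le> int d"
    using assms by (intro zdiv_mono2[of "int d" 1 "gcd r (int d)", simplified]) (auto simp: int_one_le_iff_zero_less)
  finally show ?thesis by simp
qed

text \<open>The left side is the exponent that bounds \<open>D n\<close>: \<open>22 + 2 * n\<close>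
  covers \<open>2 * 10^6 * 4 ^ n\<close> and rounding up, \<open>8 * q\<^sup>2\<close> the Gaussian,
  and the last term the separation of the nodes. With \<open>X\<close> the right side without 450,
  each of 1, \<open>n\<close>, \<open>q\<^sup>2\<close> and \<open>m\<^sup>2 * n\<close> is at most
  \<open>X\<close>, so 48 copies suffice.\<close>

lemma exponent_bound:
  fixes m q n :: nat
  assumes m: "m \<ge> 1" and q: "q \<ge> 1" and n: "n \<le> m * (2 * q + 1) ^ (m + 1)"
  shows "22 + 2 * n + 8 * q\<^sup>2 + 16 * m\<^sup>2 * n \<le> 450 * m ^ 5 * 2 ^ (18 * m\<^sup>2) * q ^ (6 * m)"
proof -
  define X where "X = m ^ 5 * 2 ^ (18 * m\<^sup>2) * q ^ (6 * m)"
  have mm: "m \<le> m\<^sup>2" using m by (simp add: power2_eq_square)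
  have "1 \<le> X" using m q by (simp add: X_def)
  have "q\<^sup>2 \<le> q ^ (6 * m)" using m q by (intro power_increasing) auto
  also have "\<dots> \<le> X" using m q by (simp add: X_def)
  finally have 1: "q\<^sup>2 \<le> X" .
  have "m\<^sup>2 * n \<le> m\<^sup>2 * (m * (2 * q + 1) ^ (m + 1))" using n by (intro mult_left_mono) auto
  also have "\<dots> \<le> m\<^sup>2 * (m * (4 * q) ^ (m + 1))" using q by (intro mult_left_mono power_mono) auto
  also have "\<dots> = m ^ 3 * 2 ^ (2 * (m + 1)) * q ^ (m + 1)"
  proof -
    have "(4 * q) ^ (m + 1) = 2 ^ (2 * (m + 1)) * q ^ (m + 1)"
      unfolding power_mult_distrib power_mult by simp
    moreover have "m\<^sup>2 * m = m ^ 3" by (simp add: power2_eq_square power3_eq_cube)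
    ultimately show ?thesis by (metis mult.assoc)
  qed
  also have "\<dots> \<le> X"
  proof -
    have "2 * (m + 1) \<le> 18 * m" using m by simp
    also have "\<dots> \<le> 18 * m\<^sup>2" using mm by simp
    finally have "(2::nat) ^ (2 * (m + 1)) \<le> 2 ^ (18 * m\<^sup>2)" by (intro power_increasing) auto
    moreover have "q ^ (m + 1) \<le> q ^ (6 * m)" "m ^ 3 \<le> m ^ 5"
      using m q by (auto intro!: power_increasing simp del: power_Suc)
    ultimately show ?thesis unfolding X_def by (intro mult_mono) auto
  qed
  finally have 2: "m\<^sup>2 * n \<le> X" .
  have "n \<le> m\<^sup>2 * n" using m by simp
  with 2 have 3: "n \<le> X" by linarith
  have "22 + 2 * n + 8 * q\<^sup>2 + 16 * (m\<^sup>2 * n) \<le> 22 * X + 2 * X + 8 * X + 16 * X"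
    using 1 2 3 \<open>1 \<le> X\<close> by linarith
  then have "22 + 2 * n + 8 * q\<^sup>2 + 16 * (m\<^sup>2 * n) \<le> 450 * X" by linarith
  then show ?thesis by (simp add: X_def mult.assoc)
qed

text \<open>Here \<open>x\<^sup>2 \<le> 4 * q\<^sup>2\<close>, and the base \<open>exp 1\<close> is
  at most \<open>2\<^sup>2\<close>, which doubles the exponent.\<close>

lemma exp_square_le:
  assumes "\<bar>x\<bar> \<le> real q + 1" and "q \<ge> 1"
  shows "exp (x\<^sup>2) \<le> real (2 * q) ^ (8 * q\<^sup>2)"
proof -
  have "\<bar>x\<bar> \<le> 2 * real q" using assms by simp
  then have "x\<^sup>2 \<le> (2 * real q)\<^sup>2"
    by (metis abs_ge_zero power2_abs power_mono)
  then have "exp (x\<^sup>2) \<le> exp (real (4 * q\<^sup>2) * 1)" by (simp add: power_mult_distrib)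
  also have "\<dots> = exp 1 ^ (4 * q\<^sup>2)" by (rule exp_of_nat_mult)
  also have "\<dots> \<le> (2\<^sup>2) ^ (4 * q\<^sup>2)"
    using exp_le by (intro power_mono) auto
  also have "\<dots> = 2 ^ (8 * q\<^sup>2)" unfolding power_mult[symmetric] by simp
  also have "\<dots> \<le> real (2 * q) ^ (8 * q\<^sup>2)" using assms by (intro power_mono) auto
  finally show ?thesis .
qed

text \<open>Heights do not decrease along the enumeration, so the height of \<open>a n\<close>
  bounds those of all earlier nodes, and one \<open>T\<close> serves both as separation and as
  diameter bound. The factor 2 in \<open>2 * T\<close> raises 15 to 16.\<close>

lemma basis_fun_node_lower_bound:
  fixes a :: "nat \<Rightarrow> real"
  assumes m: "m \<ge> 1" and a: "range a \<subseteq> algebraic_upto m" "inj a"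
    and mono: "\<And>k n. k \<le> n \<Longrightarrow> alg_height (a k) \<le> alg_height (a n)"
  defines "t \<equiv> \<lambda>n. real (2 * alg_height (a n))"
  shows "1 \<le> \<bar>basis_fun a n (a n)\<bar> * t n ^ (8 * (alg_height (a n))\<^sup>2 + 16 * m\<^sup>2 * n)"
proof -
  define q where "q = alg_height (a n)"
  define T where "T = t n ^ (15 * m\<^sup>2)"
  have alg: "algebraic (a k)" "degree (min_int_poly (a k)) \<le> m" for k
    using a(1) by (auto simp: algebraic_upto_def)
  have q: "q \<ge> 1" using alg_height_pos[OF alg(1)] by (simp add: q_def)
  have t: "t n = 2 * real q" "t n \<ge> 2" using q by (auto simp: t_def q_def)
  have bnd: "\<bar>a k\<bar> \<le> real q + 1" if "k \<le> n" for k
    using algebraic_abs_le_height[OF alg(1), of k] mono[OF that] by (simp add: q_def)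
  have "exp (- ((a n)\<^sup>2)) \<le> \<bar>basis_fun a n (a n)\<bar> * (2 * T) ^ n"
  proof (rule abs_basis_fun_node_ge)
    show "T \<ge> 1" unfolding T_def using t by (intro one_le_power) auto
    fix k assume k: "k < n"
    then have "a n \<noteq> a k" using a(2) by (auto dest: injD)
    then show "1 \<le> \<bar>a n - a k\<bar> * T"
      unfolding T_def t_def using k mono[of k n] by (intro algebraic_separation alg) auto
    have "\<bar>a n - a k\<bar> \<le> 2 * (real q + 1)" using bnd[OF less_imp_le[OF k]] bnd[OF order_refl] abs_triangle_ineq4[of "a n" "a k"] by (auto intro: order.trans)
    also have "\<dots> \<le> 4 * real q" using q by simp
    also have "\<dots> \<le> t n ^ 2" using t q by (simp add: power2_eq_square)
    also have "\<dots> \<le> T" 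
    proof -
      have "1 \<le> m\<^sup>2" using m by simp
      then show ?thesis unfolding T_def using t by (intro power_increasing) linarith+
    qed
    finally show "\<bar>a n - a k\<bar> \<le> T" .
  qed
  also have "\<dots> \<le> \<bar>basis_fun a n (a n)\<bar> * (t n ^ (16 * m\<^sup>2)) ^ n"
  proof -
    have "2 * T \<le> t n * T" using t by (intro mult_right_mono) (auto simp: T_def)
    also have "\<dots> = t n ^ Suc (15 * m\<^sup>2)" by (simp add: T_def)
    also have "\<dots> \<le> t n ^ (16 * m\<^sup>2)" using t m by (intro power_increasing) auto
    finally show ?thesis using t by (intro mult_left_mono power_mono) (auto simp: T_def)
  qed
  finally have "1 \<le> exp ((a n)\<^sup>2) * (\<bar>basis_fun a n (a n)\<bar> * (t n ^ (16 * m\<^sup>2)) ^ n)"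
    by (simp add: exp_minus field_simps)
  also have "\<dots> \<le> t n ^ (8 * q\<^sup>2) * (\<bar>basis_fun a n (a n)\<bar> * (t n ^ (16 * m\<^sup>2)) ^ n)"
    using exp_square_le[OF bnd[OF order_refl] q] t by (intro mult_right_mono) (auto intro!: mult_nonneg_nonneg)
  finally show ?thesis
    by (simp add: q_def power_add mult_ac flip: power_mult)
qed

section \<open>The family of functions indexed by sets of natural numbers\<close>

theorem theorem2:
  fixes m :: nat
  assumes "m \<ge> 1"
  shows "uncountable {\<phi> :: real \<Rightarrow> real.
           transcendental_fun \<phi> \<and> real_analytic \<phi> \<and>
           (\<forall>x. \<bar>deriv \<phi> x\<bar> < 0.0001) \<and>
           \<phi> ` real_algebraic_deg m \<subseteq> \<rat> \<and>
           (\<forall>\<alpha>\<in>real_algebraic_deg m.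
              den (\<phi> \<alpha>) \<le> (2 * alg_height \<alpha>) ^
                (450 * m ^ 5 * 2 ^ (18 * m\<^sup>2) * alg_height \<alpha> ^ (6 * m)))}"
    (is "uncountable ?S")
proof -
  obtain a :: "nat \<Rightarrow> real" where bij: "bij_betw a UNIV (algebraic_upto m)"
    and mono: "\<And>k n. k \<le> n \<Longrightarrow> alg_height (a k) \<le> alg_height (a n)"
    using rank_enumeration[OF infinite_algebraic_upto[OF assms] finite_algebraic_upto] by blast
  have a: "range a = algebraic_upto m" "inj a" using bij by (auto simp: bij_betw_def)
  define w where "w k n = (basis_fun a k (a n) :: real)" for k n
  \<comment> \<open>This is the least integer for which
    \<open>2 / (D n * \<bar>w n n\<bar>)\<close>, the bound for the coefficient, meets the
    requirement \<open>1 / (10^6 * 4 ^ n)\<close> of the series.\<close>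
  define D where "D n = nat \<lceil>2 * 10^6 * 4 ^ n / \<bar>w n n\<bar>\<rceil>" for n
  define c where "c s = interp_coeff w D s" for s
  define \<phi> where "\<phi> s = real_series a (c s)" for s
  have lower: "1 \<le> \<bar>w n n\<bar> * real (2 * alg_height (a n)) ^ (8 * (alg_height (a n))\<^sup>2 + 16 * m\<^sup>2 * n)" for n
    unfolding w_def using a by (intro basis_fun_node_lower_bound assms mono) auto
  have w0: "w n n \<noteq> 0" for n using lower[of n] by auto
  have Dge: "2 * 10^6 * 4 ^ n / \<bar>w n n\<bar> \<le> real (D n)" for n
    unfolding D_def by linarith
  have D0: "D n > 0" for n
  proof -
    have "0 < 2 * 10^6 * 4 ^ n / \<bar>w n n\<bar>" using w0[of n] by simp
    with Dge[of n] show ?thesis by linarith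
  qed
  have cb: "\<bar>c s n\<bar> \<le> 1 / (10^6 * 4 ^ n)" for s n
  proof -
    have "\<bar>c s n\<bar> \<le> 2 / (D n * \<bar>w n n\<bar>)"
      unfolding c_def by (rule interp_coeff_bound[where D = D, OF D0])
    also have "\<dots> \<le> 1 / (10^6 * 4 ^ n)"
      using Dge[of n] D0[of n] w0[of n] by (simp add: field_simps)
    finally show ?thesis .
  qed
  have at_node: "\<phi> s (a n) = (\<Sum>k\<le>n. interp_coeff w D s k * w k n)" for s n
    unfolding \<phi>_def real_series_at_node[of "c s", OF cb] by (simp add: c_def w_def)
  have val: "\<exists>r::int. r \<noteq> 0 \<and> \<phi> s (a n) = of_int r / real (D n)" for s n
    unfolding at_node interp_coeff_sum[where w = w and D = D and s = s, OF w0] using round_away(1) by blast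
  have nz: "\<phi> s x \<noteq> 0" if "x \<in> algebraic_upto m" for s x
    using val D0 that a(1) by (metis divide_eq_0_iff imageE of_int_eq_0_iff of_nat_eq_0_iff less_irrefl)
  have D_le: "D n \<le> (2 * alg_height (a n)) ^
      (450 * m ^ 5 * 2 ^ (18 * m\<^sup>2) * alg_height (a n) ^ (6 * m))" for n
  proof -
    define q where "q = alg_height (a n)"
    define t where "t = real (2 * q)"
    define E where "E = 8 * q\<^sup>2 + 16 * m\<^sup>2 * n"
    have "a n \<in> algebraic_upto m" using a(1) by blast
    then have q: "q \<ge> 1" using alg_height_pos[of "a n"] by (simp add: q_def algebraic_upto_def)
    then have t: "t \<ge> 2" by (simp add: t_def)
    \<comment> \<open>The first \<open>n + 1\<close> nodes are distinct and have height at most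
      \<open>q\<close>, so the counting bound limits \<open>n\<close> in terms of
      \<open>q\<close>.\<close>
    have "a ` {..n} \<subseteq> {\<alpha>\<in>algebraic_upto m. alg_height \<alpha> \<le> q}" using a(1) mono by (auto simp: q_def)
    then have "card (a ` {..n}) \<le> card {\<alpha>\<in>algebraic_upto m. alg_height \<alpha> \<le> q}"
      by (intro card_mono finite_algebraic_upto)
    also have "card (a ` {..n}) = Suc n" using a(2) by (simp add: card_image inj_on_def)
    finally have n: "n \<le> m * (2 * q + 1) ^ (m + 1)" using card_algebraic_upto[of m q] by linarith
    have p2: "(2::real) ^ j \<le> t ^ j" for j using t by (intro power_mono) auto
    have "1 / \<bar>w n n\<bar> \<le> t ^ E"
      using lower[of n] w0[of n] by (simp add: q_def t_def E_def field_simps)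
    \<comment> \<open>The 21 comes from \<open>2 * 10^6 \<le> 2 ^ 21\<close>.\<close>
    then have "2 * 10^6 * 4 ^ n * (1 / \<bar>w n n\<bar>) \<le> 2 ^ (21 + 2 * n) * t ^ E"
    proof (intro mult_mono)
      have "(4::real) ^ n = 2 ^ (2 * n)" by (simp add: power_mult)
      then show "2 * 10^6 * 4 ^ n \<le> (2::real) ^ (21 + 2 * n)" by (simp add: power_add)
    qed auto
    also have "\<dots> \<le> t ^ (21 + 2 * n) * t ^ E" using p2 t by (intro mult_right_mono) auto
    also have "\<dots> = t ^ (21 + 2 * n + E)" by (rule power_add[symmetric])
    \<comment> \<open>The ceiling adds at most 1, which one further factor \<open>t \<ge> 2\<close>
      absorbs.\<close>
    finally have "real (D n) \<le> t ^ (21 + 2 * n + E) + 1"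
      unfolding D_def by simp linarith
    also have "\<dots> \<le> 2 * t ^ (21 + 2 * n + E)" using one_le_power[of t "21 + 2 * n + E"] t by simp
    also have "\<dots> \<le> t * t ^ (21 + 2 * n + E)" using t by (intro mult_right_mono) auto
    also have "\<dots> = t ^ (22 + 2 * n + E)" by (simp add: eval_nat_numeral)
    also have "\<dots> \<le> t ^ (450 * m ^ 5 * 2 ^ (18 * m\<^sup>2) * q ^ (6 * m))"
      using exponent_bound[OF assms q n] t by (intro power_increasing) (auto simp: E_def)
    finally show ?thesis unfolding t_def q_def by (simp only: of_nat_power[symmetric] of_nat_le_iff)
  qed
  have "\<phi> s \<in> ?S" for s
  proof (intro CollectI conjI allI ballI)
    show "transcendental_fun (\<phi> s)"
    proof (rule transcendental_fun_rapid_decay)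
      show "(\<lambda>n. \<phi> s (real n) * real n ^ k) \<longlonglongrightarrow> 0" for k
        unfolding \<phi>_def by (rule real_series_rapid_decay[OF cb])
    qed (use nz nat_in_algebraic_upto[OF assms] in blast)
    have "real_analytic (\<lambda>x. Re (series_fun a (c s) (complex_of_real x)))"
      by (intro real_analytic_Re[OF holomorphic_series_fun[OF cb] open_strip]) (auto simp: of_real_in_strip)
    then show "real_analytic (\<phi> s)" by (simp add: \<phi>_def real_series_def [abs_def])
    show "\<bar>deriv (\<phi> s) x\<bar> < 0.0001" for x
      unfolding \<phi>_def by (rule real_series_deriv[OF cb])
    have node: "\<exists>n. \<alpha> = a n" if "\<alpha> \<in> real_algebraic_deg m" for \<alpha>
    proof -
      have "\<alpha> \<in> algebraic_upto m"
        using that by (simp add: real_algebraic_deg_def algebraic_upto_def)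
      then show ?thesis unfolding a(1)[symmetric] by (rule imageE) (rule exI)
    qed
    show "\<phi> s ` real_algebraic_deg m \<subseteq> \<rat>"
    proof clarify
      fix \<alpha> assume "\<alpha> \<in> real_algebraic_deg m"
      then obtain n where "\<alpha> = a n" using node by blast
      with val[of s n] show "\<phi> s \<alpha> \<in> \<rat>" by auto
    qed
    fix \<alpha> assume "\<alpha> \<in> real_algebraic_deg m"
    then obtain n where n: "\<alpha> = a n" using node by blast
    obtain r where "\<phi> s (a n) = of_int r / real (D n)" using val by blast
    then have "den (\<phi> s \<alpha>) \<le> D n" using den_int_divide_le[OF D0] n by simp
    with D_le[of n] show "den (\<phi> s \<alpha>) \<le> (2 * alg_height \<alpha>) ^
        (450 * m ^ 5 * 2 ^ (18 * m\<^sup>2) * alg_height \<alpha> ^ (6 * m))"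
      unfolding n by (rule order.trans[rotated])
  qed
  then have sub: "range \<phi> \<subseteq> ?S" by (rule image_subsetI)
  \<comment> \<open>The values at the nodes determine all rounding choices, hence the index
    set.\<close>
  have inj: "inj \<phi>"
  proof (rule injI)
    fix s s' assume eq: "\<phi> s = \<phi> s'"
    show "s = s'"
    proof (rule interp_coeff_inj[where D = D and w = w, OF D0 w0])
      show "(\<Sum>k\<le>n. interp_coeff w D s k * w k n) = (\<Sum>k\<le>n. interp_coeff w D s' k * w k n)" for n
        using at_node[of s n] at_node[of s' n] eq by simp
    qed
  qed
  show ?thesis
  proof
    assume "countable ?S"
    then have "countable (range \<phi>)" by (rule countable_subset[OF sub])
    then have "countable (UNIV :: nat set set)" using inj by (rule countable_image_inj_on)
    then show False using uncountable_nat_set by contradiction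
  qed
qed

end
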